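(* Let $\alpha,\beta\in(0,1)$, $\lambda_1,\lambda_2>0$, and let $\{S^{\alpha,\beta}(s,t),\ (s,t)\in\mathbb{R}^2_+\}$ be the fractional Skellam random field of type one. Its probability generating function $G^{\alpha,\beta}(u,s,t)=\mathbb{E}u^{S^{\alpha,\beta}(s,t)}$, $0<u\le1$, solves the fractional differential equation $$\frac{\partial^{\alpha+\beta}}{\partial t^{\beta}\partial s^{\alpha}}G^{\alpha,\beta}(u,s,t)=\bigg(\lambda_1(u-1)+\lambda_2\bigg(\frac{1}{u}-1\bigg)\bigg)G^{\alpha,\beta}(u,s,t)+\frac{(\lambda_1(u-1)u+\lambda_2(1-u))^2}{\lambda_1u^2-\lambda_2}\frac{\partial}{\partial u}G^{\alpha,\beta}(u,s,t),\quad \lambda_1u^2-\lambda_2\ne0,$$ with $G^{\alpha,\beta}(u,0,t)=G^{\alpha,\beta}(u,s,0)=1$.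
   Context: A Poisson random field on $\mathbb{R}^2_+$ with parameter $\lambda>0$ is a non-negative integer-valued random measure $\{N(B)\}$ indexed by Borel sets $B\subseteq\mathbb{R}^2_+$ such that $N(B)$ is Poisson with mean $\lambda|B|$ whenever the Lebesgue measure $|B|$ is finite, and $N(B_1),\dots,N(B_n)$ are independent for disjoint $B_1,\dots,B_n$. One writes $N(s,t)=N([0,s]\times[0,t])$. The Skellam random field is $S(s,t)=N_1(s,t)-N_2(s,t)$, where $N_1,N_2$ are independent Poisson random fields on $\mathbb{R}^2_+$ with parameters $\lambda_1,\lambda_2$. For $0<\alpha<1$, an $\alpha$-stable subordinator $\{H^\alpha(t),\ t\ge0\}$ is the non-decreasing Lévy process with $\mathbb{E}e^{-wH^\alpha(t)}=e^{-tw^\alpha}$, $w>0$; the inverse $\alpha$-stable subordinator is $E^\alpha(t)=\inf\{\tau>0:H^\alpha(\tau)>t\}$, $t\ge0$. The fractional Skellam random field of type one is $S^{\alpha,\beta}(s,t)=S(E_1^{\alpha}(s),E_2^{\beta}(t))$, where $E_1^\alpha$ and $E_2^\beta$ are inverse stable subordinators of indices $\alpha,\beta$, and $N_1,N_2,E_1^\alpha,E_2^\beta$ are mutually independent. Fractional derivatives are Caputo derivatives: $\frac{\mathrm{d}^\alpha}{\mathrm{d}x^\alpha}f(x)=\frac{1}{\Gamma(1-\alpha)}\int_0^x\frac{f'(y)}{(x-y)^\alpha}\,\mathrm{d}y$ for $0<\alpha<1$; $\frac{\partial^{\alpha+\beta}}{\partial t^\beta\partial s^\alpha}$ denotes the Caputo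 derivative of order $\alpha$ in $s$ followed by the Caputo derivative of order $\beta$ in $t$.
   Formalization: The equation is proved for s,t>0 at those u in (0,1] where E u^S is finite (it is infinite for u<1, u<λ2/λ1 if α+β<1, and at some points if α+β=1); ∂/∂u is taken within that set of u, so it is one-sided at its end points. *)

theory Defs
  imports "HOL-Probability.Probability"
begin

definition quadrant :: "(real \<times> real) set" where
  "quadrant = {0..} \<times> {0..}"

(* Values are natural numbers or infinity. As usual for point processes, finiteness on bounded
   sets holds for every outcome, not just almost surely: this makes the field at random
   arguments measurable without completeness of M. *)
definition integer_valued_random_measure ::
    "'w measure \<Rightarrow> ('w \<Rightarrow> (real \<times> real) measure) \<Rightarrow> bool" where
  "integer_valued_random_measure M N \<longleftrightarrow>
     (\<forall>\<omega>\<in>space M. sets (N \<omega>) = sets (restrict_space borel quadrant)) \<and>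
     (\<forall>B. B \<in> sets borel \<and> B \<subseteq> quadrant \<longrightarrow>
        (\<lambda>\<omega>. emeasure (N \<omega>) B) \<in> borel_measurable M \<and>
        (\<forall>\<omega>\<in>space M. emeasure (N \<omega>) B \<in> range ennreal_of_enat) \<and>
        (bounded B \<longrightarrow> (\<forall>\<omega>\<in>space M. emeasure (N \<omega>) B < \<infinity>)))"

(* The Poisson law is written out, since poisson_pmf is only specified for a positive rate
   while the mean vanishes on Lebesgue null sets. *)
definition poisson_random_field ::
    "'w measure \<Rightarrow> real \<Rightarrow> ('w \<Rightarrow> (real \<times> real) measure) \<Rightarrow> bool" where
  "poisson_random_field M l N \<longleftrightarrow>
     integer_valued_random_measure M N \<and>
     (\<forall>B. B \<in> sets borel \<and> B \<subseteq> quadrant \<and> emeasure lborel B < \<infinity> \<longrightarrow>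
        (\<forall>k::nat. measure M {\<omega> \<in> space M. emeasure (N \<omega>) B = of_nat k} =
           exp (- (l * measure lborel B)) * (l * measure lborel B) ^ k / fact k)) \<and>
     (\<forall>(n::nat) B. (\<forall>i<n. B i \<in> sets borel \<and> B i \<subseteq> quadrant) \<and> disjoint_family_on B {..<n} \<longrightarrow>
        prob_space.indep_vars M (\<lambda>_. borel) (\<lambda>i \<omega>. emeasure (N \<omega>) (B i)) {..<n})"

definition field_at :: "('w \<Rightarrow> (real \<times> real) measure) \<Rightarrow> real \<Rightarrow> real \<Rightarrow> 'w \<Rightarrow> real" where
  "field_at N s t \<omega> = measure (N \<omega>) ({0..s} \<times> {0..t})"

definition skellam ::
    "('w \<Rightarrow> (real \<times> real) measure) \<Rightarrow> ('w \<Rightarrow> (real \<times> real) measure) \<Rightarrow> real \<Rightarrow> real \<Rightarrow> 'w \<Rightarrow> real" where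
  "skellam N1 N2 s t \<omega> = field_at N1 s t \<omega> - field_at N2 s t \<omega>"

definition levy_process :: "'w measure \<Rightarrow> (real \<Rightarrow> 'w \<Rightarrow> real) \<Rightarrow> bool" where
  "levy_process M X \<longleftrightarrow>
     (\<forall>t\<ge>0. X t \<in> borel_measurable M) \<and>
     (AE \<omega> in M. X 0 \<omega> = 0) \<and>
     (\<forall>(n::nat) \<tau>. 0 \<le> \<tau> 0 \<and> (\<forall>i<n. \<tau> i \<le> \<tau> (Suc i)) \<longrightarrow>
        prob_space.indep_vars M (\<lambda>_. borel) (\<lambda>i \<omega>. X (\<tau> (Suc i)) \<omega> - X (\<tau> i) \<omega>) {..<n}) \<and>
     (\<forall>s\<ge>0. \<forall>h\<ge>0. distr M borel (\<lambda>\<omega>. X (s + h) \<omega> - X s \<omega>) = distr M borel (X h)) \<and>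
     (AE \<omega> in M. (\<forall>t\<ge>0. ((\<lambda>r. X r \<omega>) \<longlongrightarrow> X t \<omega>) (at_right t)) \<and>
        (\<forall>t>0. \<exists>l. ((\<lambda>r. X r \<omega>) \<longlongrightarrow> l) (at_left t)))"

definition stable_subordinator :: "'w measure \<Rightarrow> real \<Rightarrow> (real \<Rightarrow> 'w \<Rightarrow> real) \<Rightarrow> bool" where
  "stable_subordinator M \<alpha> H \<longleftrightarrow>
     levy_process M H \<and>
     (AE \<omega> in M. mono_on {0..} (\<lambda>t. H t \<omega>)) \<and>
     (\<forall>t\<ge>0. \<forall>w>0. prob_space.expectation M (\<lambda>\<omega>. exp (- w * H t \<omega>)) = exp (- t * w powr \<alpha>))"

(* For a stable subordinator the set is nonempty for almost every outcome, so the unspecified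
   value of Inf on the empty set plays no role. *)
definition inverse_process :: "(real \<Rightarrow> 'w \<Rightarrow> real) \<Rightarrow> real \<Rightarrow> 'w \<Rightarrow> real" where
  "inverse_process H t \<omega> = Inf {\<tau>. 0 < \<tau> \<and> t < H \<tau> \<omega>}"

definition process_sigma :: "'w measure \<Rightarrow> 'i set \<Rightarrow> 'b measure \<Rightarrow> ('i \<Rightarrow> 'w \<Rightarrow> 'b) \<Rightarrow> 'w set set" where
  "process_sigma M I K X =
     sigma_sets (space M) (\<Union>i\<in>I. {X i -` A \<inter> space M | A. A \<in> sets K})"

definition random_measure_sigma :: "'w measure \<Rightarrow> ('w \<Rightarrow> (real \<times> real) measure) \<Rightarrow> 'w set set" where
  "random_measure_sigma M N =
     process_sigma M {B. B \<in> sets borel \<and> B \<subseteq> quadrant} borel (\<lambda>B \<omega>. emeasure (N \<omega>) B)"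

(* The library's indep_vars and indep_sets index a single family, and indep_vars needs one value
   type; hence mutual independence is expressed through the four generated sigma-algebras. *)
definition mutually_independent ::
    "'w measure \<Rightarrow> ('w \<Rightarrow> (real \<times> real) measure) \<Rightarrow> ('w \<Rightarrow> (real \<times> real) measure) \<Rightarrow>
     (real \<Rightarrow> 'w \<Rightarrow> real) \<Rightarrow> (real \<Rightarrow> 'w \<Rightarrow> real) \<Rightarrow> bool" where
  "mutually_independent M N1 N2 E1 E2 \<longleftrightarrow>
     prob_space.indep_sets M
       (\<lambda>i::nat. [random_measure_sigma M N1, random_measure_sigma M N2,
                  process_sigma M {0..} borel E1, process_sigma M {0..} borel E2] ! i) {..<4}"

definition fractional_skellam ::
    "('w \<Rightarrow> (real \<times> real) measure) \<Rightarrow> ('w \<Rightarrow> (real \<times> real) measure) \<Rightarrow>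
     (real \<Rightarrow> 'w \<Rightarrow> real) \<Rightarrow> (real \<Rightarrow> 'w \<Rightarrow> real) \<Rightarrow> real \<Rightarrow> real \<Rightarrow> 'w \<Rightarrow> real" where
  "fractional_skellam N1 N2 E1 E2 s t \<omega> = skellam N1 N2 (E1 s \<omega>) (E2 t \<omega>) \<omega>"

definition pgf :: "'w measure \<Rightarrow> ('w \<Rightarrow> real) \<Rightarrow> real \<Rightarrow> real" where
  "pgf M X u = prob_space.expectation M (\<lambda>\<omega>. u powr X \<omega>)"

(* A variable taking negative values can have an infinite generating function at some u in (0,1];
   the Bochner integral in pgf would return 0 there. *)
definition pgf_domain :: "'w measure \<Rightarrow> ('w \<Rightarrow> real) \<Rightarrow> real set" where
  "pgf_domain M X = {u \<in> {0<..1}. integrable M (\<lambda>\<omega>. u powr X \<omega>)}"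

(* The integrand need only make sense on the open interval, since end points are Lebesgue-null;
   caputo_deriv is meaningful where caputo_differentiable holds. *)
definition caputo_differentiable :: "real \<Rightarrow> (real \<Rightarrow> real) \<Rightarrow> real \<Rightarrow> bool" where
  "caputo_differentiable \<alpha> f x \<longleftrightarrow>
     (\<forall>y\<in>{0<..<x}. f differentiable (at y)) \<and>
     set_integrable lborel {0<..<x} (\<lambda>y. deriv f y / (x - y) powr \<alpha>)"

definition caputo_deriv :: "real \<Rightarrow> (real \<Rightarrow> real) \<Rightarrow> real \<Rightarrow> real" where
  "caputo_deriv \<alpha> f x =
     1 / Gamma (1 - \<alpha>) * (LINT y:{0<..<x}|lborel. deriv f y / (x - y) powr \<alpha>)"

end

theory Submission
  imports Defs "HOL-Real_Asymp.Real_Asymp"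
begin

text \<open>
  Put \<open>c = l1 * (u - 1) + l2 * (1 / u - 1)\<close>. At a deterministic point \<open>(a, b)\<close> the Skellam field has
  generating function \<open>exp (c * a * b)\<close>, so inserting the independent times gives
  \<open>G u s t = E (exp (c * E1 s * E2 t))\<close>. The inverse of a stable subordinator is self-similar:
  \<open>E1 s\<close> has the law of \<open>s powr \<alpha> * X\<close> with \<open>X = H1 1 powr (- \<alpha>)\<close>, and likewise \<open>E2 t\<close> that of
  \<open>t powr \<beta> * Y\<close>. Hence \<open>G\<close> is the exponential transform of \<open>Z = X * Y\<close> at
  \<open>z = c * s powr \<alpha> * t powr \<beta>\<close>, where \<open>X\<close> and \<open>Y\<close> are independent Mittag-Leffler variables.

  The equation comes from one rule: the Caputo derivative of order \<open>\<alpha>\<close> of \<open>E (h (E1 s))\<close> in \<open>s\<close> is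
  \<open>E (h' (E1 s))\<close>. Applied in \<open>s\<close> and then in \<open>t\<close> to \<open>exp (c * x * y)\<close>, whose mixed derivative in \<open>x\<close>
  and \<open>y\<close> is \<open>(c + c\<^sup>2 * x * y) * exp (c * x * y)\<close>, it gives \<open>c * G\<close> plus \<open>c\<^sup>2\<close> times the derivative of
  \<open>G\<close> in \<open>c\<close>. The chain rule with \<open>dc/du = (l1 * u\<^sup>2 - l2) / u\<^sup>2\<close> turns the latter into the derivative
  in \<open>u\<close>.

  Expanding \<open>G\<close> in powers of \<open>c\<close> would prove this only when the series converges; for
  \<open>\<alpha> + \<beta> < 1\<close> it diverges unless \<open>c = 0\<close>, although \<open>G\<close> is finite for every \<open>c \<le> 0\<close>. The rule is
  therefore proved as an equality of two laws (\<open>nn_integral_caputo_kernel_law\<close>): weighting the law of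
  \<open>r powr \<alpha> * X\<close> by \<open>X\<close> and by the Caputo kernel in \<open>r\<close> reproduces the law of \<open>s powr \<alpha> * X\<close>. Both
  laws have the moments of a Mittag-Leffler variable, which determine them
  (\<open>real_distribution_eq_if_moments_eq\<close>). An equality of laws carries over to every integrand that
  also depends on the other, independent variable, which is \<open>caputo_if_kernel_derivative\<close>.

  What remains is integrability. At a positive \<open>z\<close> where \<open>exp (z * Z)\<close> is integrable, the derivatives
  need the same for \<open>Z * exp (z * Z)\<close>. This holds because the set of such \<open>z\<close> has no largest positive
  element (\<open>summable_stable_product_open\<close>); the delicate case is \<open>\<alpha> + \<beta> = 1\<close>, where the power series
  has a finite radius of convergence and diverges there.
\<close>

section \<open>Laws determined by their moments\<close>

lemma integral_exp_series:
  fixes P :: "real measure" and w :: complex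
  assumes P: "real_distribution P" and e: "\<And>r. integrable P (\<lambda>x. exp (r * \<bar>x\<bar>))"
  shows "(\<lambda>n. w ^ n / fact n * of_real (LINT x|P. x ^ n)) sums (LINT x|P. exp (w * of_real x))"
proof -
  interpret real_distribution P by (rule P)
  let ?f = "\<lambda>n x. w ^ n / fact n * of_real (x ^ n) :: complex"
  have norm_f: "norm (?f n x) = (norm w * \<bar>x\<bar>) ^ n / fact n" for n x
    by (simp add: norm_mult norm_power norm_divide power_mult_distrib power_abs)
  have sums_exp: "(\<lambda>n. (norm w * \<bar>x\<bar>) ^ n / fact n) sums exp (norm w * \<bar>x\<bar>)" for x :: real
    using exp_converges[of "norm w * \<bar>x\<bar>"] by (simp add: divide_inverse mult.commute)
  have partial_le_exp: "(\<Sum>n\<in>K. (norm w * \<bar>x\<bar>) ^ n / fact n) \<le> exp (norm w * \<bar>x\<bar>)"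
    if "finite K" for K and x :: real
    unfolding sums_unique[OF sums_exp]
    by (intro sum_le_suminf sums_summable[OF sums_exp] that) auto
  have le_exp: "(norm w * \<bar>x\<bar>) ^ n / fact n \<le> exp (norm w * \<bar>x\<bar>)" for n and x :: real
    using partial_le_exp[of "{n}" x] by simp
  have int_f: "integrable P (?f n)" for n
    by (rule Bochner_Integration.integrable_bound[OF e[of "norm w"]], measurable)
       (intro AE_I2, simp only: norm_f le_exp real_norm_def abs_exp_cancel)
  have int_n: "integrable P (\<lambda>x. (norm w * \<bar>x\<bar>) ^ n / fact n)" for n
    using integrable_norm[OF int_f[of n]] by (simp only: norm_f)
  have "summable (\<lambda>n. LINT x|P. norm (?f n x))"
  proof (rule summableI_nonneg_bounded)
    show "0 \<le> (LINT x|P. norm (?f n x))" for n by simp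
    show "(\<Sum>n<k. LINT x|P. norm (?f n x)) \<le> (LINT x|P. exp (norm w * \<bar>x\<bar>))" for k
    proof -
      have "(\<Sum>n<k. LINT x|P. norm (?f n x)) = (LINT x|P. (\<Sum>n<k. (norm w * \<bar>x\<bar>) ^ n / fact n))"
        unfolding norm_f by (rule Bochner_Integration.integral_sum[symmetric]) (rule int_n)
      also have "\<dots> \<le> (LINT x|P. exp (norm w * \<bar>x\<bar>))"
        by (intro integral_mono Bochner_Integration.integrable_sum int_n e partial_le_exp finite_lessThan)
      finally show ?thesis .
    qed
  qed
  moreover have "AE x in P. summable (\<lambda>n. norm (?f n x))"
    unfolding norm_f using sums_exp by (auto simp: sums_iff)
  ultimately have "(\<lambda>n. LINT x|P. ?f n x) sums (LINT x|P. (\<Sum>n. ?f n x))"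
    by (intro sums_integral int_f)
  moreover have "(\<Sum>n. ?f n x) = exp (w * of_real x)" for x
    by (simp add: exp_def scaleR_conv_of_real power_mult_distrib divide_inverse mult_ac)
  moreover have "(LINT x|P. ?f n x) = w ^ n / fact n * of_real (LINT x|P. x ^ n)" for n
    by (simp only: integral_mult_right_zero integral_complex_of_real)
  ultimately show ?thesis by (simp only:)
qed

text \<open>
  If all exponential moments are finite, the characteristic function is the sum of its Taylor series,
  whose coefficients are the moments; Levy's uniqueness theorem does the rest.
\<close>

lemma real_distribution_eq_if_moments_eq:
  assumes P: "real_distribution P" "\<And>r. integrable P (\<lambda>x. exp (r * \<bar>x\<bar>))"
    and Q: "real_distribution Q" "\<And>r. integrable Q (\<lambda>x. exp (r * \<bar>x\<bar>))"
    and eq: "\<And>n::nat. (LINT x|P. x ^ n) = (LINT x|Q. x ^ n)"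
  shows "P = Q"
proof (rule Levy_uniqueness[OF P(1) Q(1)])
  have "char P t = char Q t" for t
  proof -
    have "(LINT x|P. exp ((\<i> * of_real t) * of_real x)) = (LINT x|Q. exp ((\<i> * of_real t) * of_real x))"
      by (rule sums_unique2[OF integral_exp_series[OF P]])
         (use integral_exp_series[OF Q, of "\<i> * of_real t"] in \<open>simp add: eq\<close>)
    thus ?thesis by (simp add: char_def mult_ac)
  qed
  thus "char P = char Q" by blast
qed

lemma power_le_fact_mult_exp:
  fixes x :: real assumes "0 \<le> x" shows "x ^ j \<le> fact j * exp x"
proof -
  have "(\<lambda>n. x ^ n / fact n) sums exp x"
    using exp_converges[of x] by (simp add: divide_inverse mult.commute)
  hence "(\<Sum>n\<in>{j}. x ^ n / fact n) \<le> exp x"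
    using assms by (metis (no_types, lifting) finite.emptyI finite.insertI sum_le_suminf sums_iff
      zero_le_divide_iff fact_ge_zero zero_le_power)
  thus ?thesis by (simp add: field_simps)
qed

lemma nn_integral_exp_eq_series:
  assumes [measurable]: "Z \<in> borel_measurable M" and Z: "\<And>\<omega>. 0 \<le> Z \<omega>" and z: "0 \<le> (z :: real)"
  shows "(\<integral>\<^sup>+\<omega>. ennreal (exp (z * Z \<omega>)) \<partial>M) = (\<Sum>n. ennreal (z ^ n / fact n) * (\<integral>\<^sup>+\<omega>. ennreal (Z \<omega> ^ n) \<partial>M))"
proof -
  have c: "0 \<le> z ^ n / fact n" for n using z by simp
  have sums: "(\<lambda>n. (z ^ n / fact n) * Z \<omega> ^ n) sums exp (z * Z \<omega>)" for \<omega>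
    using exp_converges[of "z * Z \<omega>"] by (simp add: divide_inverse power_mult_distrib mult_ac)
  have "(\<Sum>n. ennreal (z ^ n / fact n) * (\<integral>\<^sup>+\<omega>. ennreal (Z \<omega> ^ n) \<partial>M)) =
      (\<Sum>n. \<integral>\<^sup>+\<omega>. ennreal ((z ^ n / fact n) * Z \<omega> ^ n) \<partial>M)"
    by (intro suminf_cong, simp only: ennreal_mult'[OF c], rule nn_integral_cmult[symmetric]) measurable
  also have "\<dots> = (\<integral>\<^sup>+\<omega>. (\<Sum>n. ennreal ((z ^ n / fact n) * Z \<omega> ^ n)) \<partial>M)"
    by (rule nn_integral_suminf[symmetric]) measurable
  also have "\<dots> = (\<integral>\<^sup>+\<omega>. ennreal (exp (z * Z \<omega>)) \<partial>M)"
    using z Z by (intro nn_integral_cong suminf_ennreal_eq sums) auto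
  finally show ?thesis ..
qed

text \<open>
  Nonnegative integrals make the moment series of an exponential valid without any integrability
  assumption, so that finiteness of the exponential moments needs to be known on one side only.
\<close>

lemma distr_eq_if_nn_moments_eq:
  fixes Z :: "'a \<Rightarrow> real" and W :: "'b \<Rightarrow> real"
  assumes [measurable]: "Z \<in> borel_measurable M" "W \<in> borel_measurable N"
    and nonneg: "\<And>\<omega>. 0 \<le> Z \<omega>" "\<And>\<omega>. 0 \<le> W \<omega>"
    and eq: "\<And>n::nat. (\<integral>\<^sup>+\<omega>. ennreal (Z \<omega> ^ n) \<partial>M) = (\<integral>\<^sup>+\<omega>. ennreal (W \<omega> ^ n) \<partial>N)"
    and N: "prob_space N"
    and fin: "\<And>r. 0 \<le> r \<Longrightarrow> (\<integral>\<^sup>+\<omega>. ennreal (exp (r * W \<omega>)) \<partial>N) < \<infinity>"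
  shows "distr M borel Z = distr N borel W"
proof -
  interpret N: prob_space N by (rule N)
  interpret M: prob_space M
    by (rule prob_spaceI) (use eq[of 0] in \<open>simp add: N.emeasure_space_1\<close>)
  have exp_mom: "integrable (distr P borel Y) (\<lambda>x. exp (r * \<bar>x\<bar>))"
    if [measurable]: "Y \<in> borel_measurable P" and Y: "\<And>\<omega>. 0 \<le> Y \<omega>"
      and fin: "(\<integral>\<^sup>+\<omega>. ennreal (exp (\<bar>r\<bar> * Y \<omega>)) \<partial>P) < \<infinity>"
    for Y :: "'c \<Rightarrow> real" and P r
  proof (subst integrable_distr_eq)
    have "integrable P (\<lambda>\<omega>. exp (\<bar>r\<bar> * Y \<omega>))"
      using fin by (intro integrableI_nonneg) auto
    thus "integrable P (\<lambda>\<omega>. exp (r * \<bar>Y \<omega>\<bar>))"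
      by (rule Bochner_Integration.integrable_bound) (use Y in \<open>auto intro!: AE_I2 mult_right_mono\<close>)
  qed measurable
  have mom: "(LINT x|distr P borel Y. x ^ n) = enn2real (\<integral>\<^sup>+\<omega>. ennreal (Y \<omega> ^ n) \<partial>P)"
    if [measurable]: "Y \<in> borel_measurable P" and "\<And>\<omega>. 0 \<le> Y \<omega>" for Y :: "'c \<Rightarrow> real" and P n
    using that(2) by (simp add: integral_distr integral_eq_nn_integral)
  have fin': "(\<integral>\<^sup>+\<omega>. ennreal (exp (r * Z \<omega>)) \<partial>M) < \<infinity>" if "0 \<le> r" for r
    using fin[OF that] that nonneg by (simp add: nn_integral_exp_eq_series eq)
  show ?thesis
  proof (rule real_distribution_eq_if_moments_eq)
    show "real_distribution (distr M borel Z)" "real_distribution (distr N borel W)"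
      by (simp_all add: M.real_distribution_distr N.real_distribution_distr)
    show "(LINT x|distr M borel Z. x ^ n) = (LINT x|distr N borel W. x ^ n)" for n
      using nonneg by (simp add: mom eq)
  qed (use fin fin' nonneg in \<open>auto intro!: exp_mom\<close>)
qed

section \<open>Stable subordinators and their inverses\<close>

text \<open>
  The two inequalities say that the tails of \<open>A\<close> and \<open>B\<close> agree up to atoms, which a right-continuous
  distribution function cannot distinguish. This suits an inverse process \<open>A\<close>, for which the events
  \<open>H x \<le> s\<close> lie between \<open>x < A\<close> and \<open>x \<le> A\<close>.
\<close>

lemma distr_eq_if_tails_interlace:
  fixes A B :: "'w \<Rightarrow> real"
  assumes M: "prob_space M" and [measurable]: "A \<in> borel_measurable M" "B \<in> borel_measurable M"
    and nonneg: "AE \<omega> in M. 0 \<le> A \<omega>" "AE \<omega> in M. 0 \<le> B \<omega>"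
    and le1: "\<And>x. 0 < x \<Longrightarrow> measure M {\<omega> \<in> space M. x < A \<omega>} \<le> measure M {\<omega> \<in> space M. x \<le> B \<omega>}"
    and le2: "\<And>x. 0 < x \<Longrightarrow> measure M {\<omega> \<in> space M. x \<le> B \<omega>} \<le> measure M {\<omega> \<in> space M. x \<le> A \<omega>}"
  shows "distr M borel A = distr M borel B"
proof (rule cdf_unique)
  interpret prob_space M by (rule M)
  show rA: "real_distribution (distr M borel A)" and rB: "real_distribution (distr M borel B)"
    by (simp_all add: real_distribution_distr)
  interpret dA: real_distribution "distr M borel A" by (rule rA)
  interpret dB: real_distribution "distr M borel B" by (rule rB)
  have cdf: "cdf (distr M borel C) x = prob {\<omega> \<in> space M. C \<omega> \<le> x}"
    if [measurable]: "C \<in> borel_measurable M" for C :: "'w \<Rightarrow> real" and x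
    by (simp add: cdf_def measure_distr vimage_def Int_def conj_commute)
  have neg: "prob {\<omega> \<in> space M. C \<omega> \<le> x} = 0"
    if "x < 0" "AE \<omega> in M. 0 \<le> C \<omega>" "C \<in> borel_measurable M" for C :: "'w \<Rightarrow> real" and x
    using that by (intro prob_eq_0_AE) auto
  have compl1: "prob {\<omega> \<in> space M. C \<omega> \<le> x} = 1 - prob {\<omega> \<in> space M. x < C \<omega>}"
    if [measurable]: "C \<in> borel_measurable M" for C :: "'w \<Rightarrow> real" and x
    by (subst prob_compl[symmetric]) (auto intro!: arg_cong[where f=prob])
  have compl2: "prob {\<omega> \<in> space M. C \<omega> < x} = 1 - prob {\<omega> \<in> space M. x \<le> C \<omega>}"
    if [measurable]: "C \<in> borel_measurable M" for C :: "'w \<Rightarrow> real" and x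
    by (subst prob_compl[symmetric]) (auto intro!: arg_cong[where f=prob])
  have step: "prob {\<omega> \<in> space M. C \<omega> \<le> x} \<le> prob {\<omega> \<in> space M. C \<omega> < y}"
    if "x < y" and [measurable]: "C \<in> borel_measurable M" for C :: "'w \<Rightarrow> real" and x y
    using that by (intro finite_measure_mono) auto
  have right: "(cdf (distr M borel C) \<longlongrightarrow> cdf (distr M borel C) x) (at_right x)"
    if "real_distribution (distr M borel C)" for C :: "'w \<Rightarrow> real" and x
    using finite_borel_measure.cdf_is_right_cont[OF real_distribution.finite_borel_measure_M[OF that]]
    by (simp add: continuous_within)
  have ev: "\<forall>\<^sub>F y in at_right x. x < y" for x :: real
    by (simp add: eventually_at_right_less)
  show "cdf (distr M borel A) = cdf (distr M borel B)"
  proof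
    fix x :: real
    show "cdf (distr M borel A) x = cdf (distr M borel B) x"
    proof (cases "x < 0")
      case True
      thus ?thesis using nonneg by (simp add: cdf neg)
    next
      case False
      have AB: "cdf (distr M borel A) x \<le> cdf (distr M borel B) y" if "x < y" for y
      proof -
        have "cdf (distr M borel A) x \<le> prob {\<omega> \<in> space M. A \<omega> < y}"
          using step[OF that, of A] by (simp add: cdf)
        also have "\<dots> \<le> prob {\<omega> \<in> space M. B \<omega> < y}"
          using le2[of y] that False by (simp add: compl2)
        also have "\<dots> \<le> prob {\<omega> \<in> space M. B \<omega> \<le> y}"
          by (intro finite_measure_mono) auto
        finally show ?thesis by (simp add: cdf)
      qed
      have BA: "cdf (distr M borel B) x \<le> cdf (distr M borel A) y" if "x < y" for y
      proof -
        have "cdf (distr M borel B) x \<le> prob {\<omega> \<in> space M. B \<omega> < y}"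
          using step[OF that, of B] by (simp add: cdf)
        also have "\<dots> \<le> prob {\<omega> \<in> space M. A \<omega> \<le> y}"
          using le1[of y] that False by (simp add: compl1 compl2)
        finally show ?thesis by (simp add: cdf)
      qed
      show ?thesis
      proof (rule antisym)
        show "cdf (distr M borel A) x \<le> cdf (distr M borel B) x"
          by (rule tendsto_lowerbound[OF right[OF rB]])
             (use ev[of x] AB in \<open>auto elim!: eventually_mono\<close>)
        show "cdf (distr M borel B) x \<le> cdf (distr M borel A) x"
          by (rule tendsto_lowerbound[OF right[OF rA]])
             (use ev[of x] BA in \<open>auto elim!: eventually_mono\<close>)
      qed
    qed
  qed
qed

locale subordinator = prob_space M for M :: "'w measure" +
  fixes \<alpha> :: real and H :: "real \<Rightarrow> 'w \<Rightarrow> real"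
  assumes index: "0 < \<alpha>" "\<alpha> < 1" and stable: "stable_subordinator M \<alpha> H"
begin

lemma measurable_H [measurable]: "0 \<le> x \<Longrightarrow> H x \<in> borel_measurable M"
  using stable by (simp add: stable_subordinator_def levy_process_def)

lemma measurable_H1 [measurable]: "H 1 \<in> borel_measurable M"
  by (rule measurable_H) simp

lemma AE_mono: "AE \<omega> in M. mono_on {0..} (\<lambda>t. H t \<omega>)"
  using stable by (simp add: stable_subordinator_def)

lemma AE_nonneg: "AE \<omega> in M. \<forall>x\<ge>0. 0 \<le> H x \<omega>"
proof -
  have "AE \<omega> in M. H 0 \<omega> = 0"
    using stable by (simp add: stable_subordinator_def levy_process_def)
  with AE_mono show ?thesis
    by eventually_elim (auto simp: mono_on_def dest: spec[where x=0])
qed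

lemma laplace: "0 \<le> x \<Longrightarrow> 0 < w \<Longrightarrow> expectation (\<lambda>\<omega>. exp (- w * H x \<omega>)) = exp (- x * w powr \<alpha>)"
  using stable by (simp add: stable_subordinator_def)

lemma integrable_laplace:
  assumes "0 \<le> x" "0 \<le> w" shows "integrable M (\<lambda>\<omega>. exp (- (w * H x \<omega>)))"
proof (rule integrable_const_bound[where B=1])
  show "AE \<omega> in M. norm (exp (- (w * H x \<omega>))) \<le> 1"
    using AE_nonneg by eventually_elim (use assms in auto)
qed (use assms in measurable)

text \<open>
  Markov's inequality for \<open>exp (- w * H x)\<close>.
\<close>

lemma prob_le_bound:
  assumes "0 \<le> x" "0 < w"
  shows "prob {\<omega> \<in> space M. H x \<omega> \<le> s} \<le> exp (w * s - x * w powr \<alpha>)"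
proof -
  note [measurable] = measurable_H[OF assms(1)]
  have "prob {\<omega> \<in> space M. H x \<omega> \<le> s} = expectation (indicator {\<omega> \<in> space M. H x \<omega> \<le> s})"
    by (auto simp: Int_def intro!: arg_cong[where f=prob])
  also have "\<dots> \<le> expectation (\<lambda>\<omega>. exp (w * s) * exp (- (w * H x \<omega>)))"
  proof (rule integral_mono)
    show "indicator {\<omega> \<in> space M. H x \<omega> \<le> s} \<omega> \<le> exp (w * s) * exp (- (w * H x \<omega>))" for \<omega>
      using assms by (auto simp: indicator_def mult_left_mono simp flip: exp_add)
  qed (use integrable_laplace assms in \<open>auto simp: emeasure_eq_measure\<close>)
  also have "\<dots> = exp (w * s - x * w powr \<alpha>)"
    using laplace[OF assms] by (simp add: exp_diff exp_minus divide_inverse)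
  finally show ?thesis .
qed

lemma AE_H1_pos: "AE \<omega> in M. 0 < H 1 \<omega>"
proof -
  have "prob {\<omega> \<in> space M. H 1 \<omega> \<le> 0} \<le> 0"
  proof (rule tendsto_lowerbound)
    show "((\<lambda>w. exp (- (w powr \<alpha>))) \<longlongrightarrow> 0) at_top"
      using index by real_asymp
    show "\<forall>\<^sub>F w in at_top. prob {\<omega> \<in> space M. H 1 \<omega> \<le> 0} \<le> exp (- (w powr \<alpha>))"
      using eventually_gt_at_top[of 0]
      by eventually_elim (use prob_le_bound[of 1 _ 0] in auto)
  qed simp
  hence "prob {\<omega> \<in> space M. H 1 \<omega> \<le> 0} = 0"
    by (simp add: measure_le_0_iff)
  hence "AE \<omega> in M. \<not> H 1 \<omega> \<le> 0"
    by (subst (asm) prob_eq_0) auto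
  thus ?thesis by eventually_elim auto
qed

lemma AE_unbounded: "AE \<omega> in M. \<exists>\<tau>>0. s < H \<tau> \<omega>"
proof -
  have m [measurable]: "H (real (Suc n)) \<in> borel_measurable M" for n
    by (rule measurable_H) simp
  have "prob {\<omega> \<in> space M. \<forall>n. H (real (Suc n)) \<omega> \<le> s} \<le> 0"
  proof (rule LIMSEQ_le_const)
    show "(\<lambda>n. exp (s - real (Suc n))) \<longlonglongrightarrow> 0" by real_asymp
    show "\<exists>N. \<forall>n\<ge>N. prob {\<omega> \<in> space M. \<forall>n. H (real (Suc n)) \<omega> \<le> s} \<le> exp (s - real (Suc n))"
    proof (intro exI allI impI)
      fix n
      have "prob {\<omega> \<in> space M. \<forall>n. H (real (Suc n)) \<omega> \<le> s} \<le> prob {\<omega> \<in> space M. H (real (Suc n)) \<omega> \<le> s}"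
        by (intro finite_measure_mono) auto
      also have "\<dots> \<le> exp (s - real (Suc n))"
        using prob_le_bound[of "real (Suc n)" 1 s] by simp
      finally show "prob {\<omega> \<in> space M. \<forall>n. H (real (Suc n)) \<omega> \<le> s} \<le> exp (s - real (Suc n))" .
    qed
  qed
  hence "prob {\<omega> \<in> space M. \<forall>n. H (real (Suc n)) \<omega> \<le> s} = 0"
    by (simp add: measure_le_0_iff)
  hence "AE \<omega> in M. \<not> (\<forall>n. H (real (Suc n)) \<omega> \<le> s)"
    by (subst (asm) prob_eq_0) auto
  thus ?thesis
  proof eventually_elim
    case (elim \<omega>)
    then obtain n where "s < H (real (Suc n)) \<omega>" by (auto simp: not_le)
    thus ?case by (intro exI[of _ "real (Suc n)"]) auto
  qed
qed

text \<open>
  Both variables take values in the unit interval, and their moments are values of the Laplace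
  transform at the integers: \<open>exp (- x * n powr \<alpha>)\<close> in either case. Passing to \<open>exp (- H x)\<close> is what
  makes the moments finite.
\<close>

lemma self_similar:
  assumes x: "0 < x"
  shows "distr M borel (\<lambda>\<omega>. exp (- H x \<omega>)) = distr M borel (\<lambda>\<omega>. exp (- (x powr (1 / \<alpha>) * H 1 \<omega>)))"
    (is "distr M borel ?U = distr M borel ?V")
proof -
  have [measurable]: "H x \<in> borel_measurable M" by (rule measurable_H) (use x in simp)
  have mU: "?U \<in> borel_measurable M" and mV: "?V \<in> borel_measurable M" by measurable
  have exp_mom: "integrable (distr M borel U) (\<lambda>x. exp (r * \<bar>x\<bar>))"
    if [measurable]: "U \<in> borel_measurable M" and "AE \<omega> in M. 0 \<le> U \<omega> \<and> U \<omega> \<le> 1"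
    for U :: "'w \<Rightarrow> real" and r
  proof (subst integrable_distr_eq)
    show "integrable M (\<lambda>\<omega>. exp (r * \<bar>U \<omega>\<bar>))"
    proof (rule integrable_const_bound[where B="exp \<bar>r\<bar>"])
      show "AE \<omega> in M. norm (exp (r * \<bar>U \<omega>\<bar>)) \<le> exp \<bar>r\<bar>"
        using that(2)
      proof eventually_elim
        case (elim \<omega>)
        have "r * \<bar>U \<omega>\<bar> \<le> \<bar>r\<bar> * 1"
          using elim by (intro mult_mono) auto
        thus ?case by simp
      qed
    qed measurable
  qed measurable
  show ?thesis
  proof (rule real_distribution_eq_if_moments_eq)
    show "real_distribution (distr M borel ?U)" "real_distribution (distr M borel ?V)"
      by (auto intro!: real_distribution_distr)
    show "integrable (distr M borel ?U) (\<lambda>x. exp (r * \<bar>x\<bar>))" for r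
    proof (rule exp_mom[OF mU])
      show "AE \<omega> in M. 0 \<le> ?U \<omega> \<and> ?U \<omega> \<le> 1"
        using AE_nonneg by eventually_elim (use x in auto)
    qed
    show "integrable (distr M borel ?V) (\<lambda>x. exp (r * \<bar>x\<bar>))" for r
    proof (rule exp_mom[OF mV])
      show "AE \<omega> in M. 0 \<le> ?V \<omega> \<and> ?V \<omega> \<le> 1"
        using AE_nonneg by eventually_elim (use x in auto)
    qed
    show "(LINT y|distr M borel ?U. y ^ n) = (LINT y|distr M borel ?V. y ^ n)" for n
    proof (cases "n = 0")
      case False
      have "(LINT y|distr M borel ?U. y ^ n) = expectation (\<lambda>\<omega>. exp (- real n * H x \<omega>))"
        by (subst integral_distr) (auto simp flip: exp_of_nat_mult)
      also have "\<dots> = exp (- x * real n powr \<alpha>)"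
        using False x by (intro laplace) auto
      also have "\<dots> = exp (- 1 * (real n * x powr (1 / \<alpha>)) powr \<alpha>)"
        using x index by (simp add: powr_mult powr_powr)
      also have "\<dots> = expectation (\<lambda>\<omega>. exp (- (real n * x powr (1 / \<alpha>)) * H 1 \<omega>))"
        using False x by (intro laplace[symmetric]) auto
      also have "\<dots> = (LINT y|distr M borel ?V. y ^ n)"
        by (subst integral_distr) (auto simp: mult.assoc simp flip: exp_of_nat_mult)
      finally show ?thesis .
    qed (simp add: measure_distr prob_space)
  qed
qed

lemma le_iff_inverse:
  assumes "0 < x" "0 \<le> s" "0 < h"
  shows "x powr (1 / \<alpha>) * h \<le> s \<longleftrightarrow> x \<le> s powr \<alpha> * h powr (- \<alpha>)"
proof (cases "s = 0")
  case True
  thus ?thesis using assms index by (auto simp: mult_le_0_iff)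
next
  case False
  hence s: "0 < s" using assms by simp
  have "x powr (1 / \<alpha>) * h \<le> s \<longleftrightarrow> ln (x powr (1 / \<alpha>) * h) \<le> ln s"
    using assms s by (subst ln_le_cancel_iff) auto
  also have "\<dots> \<longleftrightarrow> ln x \<le> \<alpha> * ln s - \<alpha> * ln h"
    using assms s index by (simp add: ln_mult ln_powr field_simps)
  also have "\<dots> \<longleftrightarrow> ln x \<le> ln (s powr \<alpha> * h powr (- \<alpha>))"
    using assms s by (simp add: ln_mult ln_powr)
  also have "\<dots> \<longleftrightarrow> x \<le> s powr \<alpha> * h powr (- \<alpha>)"
    using assms s by (subst ln_le_cancel_iff) auto
  finally show ?thesis .
qed

lemma prob_H_le:
  assumes x: "0 < x" and s: "0 \<le> s"
  shows "prob {\<omega> \<in> space M. H x \<omega> \<le> s} = prob {\<omega> \<in> space M. x \<le> s powr \<alpha> * H 1 \<omega> powr (- \<alpha>)}"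
proof -
  have [measurable]: "H x \<in> borel_measurable M" by (rule measurable_H) (use x in simp)
  have "prob {\<omega> \<in> space M. H x \<omega> \<le> s} = measure (distr M borel (\<lambda>\<omega>. exp (- H x \<omega>))) {exp (- s)..}"
    by (subst measure_distr) (auto simp: vimage_def Int_def conj_commute)
  also have "\<dots> = prob {\<omega> \<in> space M. x powr (1 / \<alpha>) * H 1 \<omega> \<le> s}"
    unfolding self_similar[OF x] by (subst measure_distr) (auto simp: vimage_def Int_def conj_commute)
  also have "\<dots> = prob {\<omega> \<in> space M. x \<le> s powr \<alpha> * H 1 \<omega> powr (- \<alpha>)}"
    by (rule measure_eq_AE) (use AE_H1_pos in \<open>auto elim!: eventually_mono simp: le_iff_inverse[OF x s]\<close>)
  finally show ?thesis .
qed

text \<open>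
  The infimum defining the inverse process is taken over a set that is almost surely nonempty and, by
  monotonicity of the paths, an up-set.
\<close>

lemma AE_inverse_process:
  assumes s: "0 \<le> s"
  shows "AE \<omega> in M. 0 \<le> inverse_process H s \<omega> \<and>
    (\<forall>x>0. (x < inverse_process H s \<omega> \<longrightarrow> H x \<omega> \<le> s) \<and> (H x \<omega> \<le> s \<longrightarrow> x \<le> inverse_process H s \<omega>))"
  using AE_mono AE_unbounded[of s]
proof eventually_elim
  case (elim \<omega>)
  let ?S = "{\<tau>. 0 < \<tau> \<and> s < H \<tau> \<omega>}"
  have ne: "?S \<noteq> {}" using elim by auto
  have bdd: "bdd_below ?S" by (intro bdd_belowI[of _ 0]) auto
  have "0 \<le> Inf ?S" by (rule cInf_greatest[OF ne]) auto
  moreover have "H x \<omega> \<le> s" if "0 < x" "x < Inf ?S" for x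
  proof (rule ccontr)
    assume "\<not> H x \<omega> \<le> s"
    hence "Inf ?S \<le> x" using that by (intro cInf_lower[OF _ bdd]) auto
    thus False using that by simp
  qed
  moreover have "x \<le> Inf ?S" if "0 < x" "H x \<omega> \<le> s" for x
  proof (rule cInf_greatest[OF ne])
    fix \<tau> assume "\<tau> \<in> ?S"
    hence \<tau>: "0 < \<tau>" "s < H \<tau> \<omega>" by auto
    show "x \<le> \<tau>"
    proof (rule ccontr)
      assume "\<not> x \<le> \<tau>"
      hence "H \<tau> \<omega> \<le> H x \<omega>" using \<tau> by (intro mono_onD[OF elim(1)]) auto
      thus False using \<tau> that by simp
    qed
  qed
  ultimately show ?case by (simp add: inverse_process_def)
qed

text \<open>
  The events that interlace with the tails of the inverse process have, by self-similarity, the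
  probabilities of the tails of \<open>s powr \<alpha> * H 1 powr (- \<alpha>)\<close>. The case \<open>s = 0\<close> is included and says
  that the inverse process starts at \<open>0\<close>.
\<close>

lemma distr_inverse_process:
  assumes s: "0 \<le> s" and [measurable]: "inverse_process H s \<in> borel_measurable M"
  shows "distr M borel (inverse_process H s) = distr M borel (\<lambda>\<omega>. s powr \<alpha> * H 1 \<omega> powr (- \<alpha>))"
proof (rule distr_eq_if_tails_interlace[OF prob_space_axioms])
  show "AE \<omega> in M. 0 \<le> inverse_process H s \<omega>"
    using AE_inverse_process[OF s] by eventually_elim auto
  fix x :: real assume x: "0 < x"
  have [measurable]: "H x \<in> borel_measurable M" by (rule measurable_H) (use x in simp)
  show "prob {\<omega> \<in> space M. x < inverse_process H s \<omega>} \<le> prob {\<omega> \<in> space M. x \<le> s powr \<alpha> * H 1 \<omega> powr - \<alpha>}"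
    unfolding prob_H_le[OF x s, symmetric]
    by (rule finite_measure_mono_AE, use AE_inverse_process[OF s] in eventually_elim) (use x in auto)
  show "prob {\<omega> \<in> space M. x \<le> s powr \<alpha> * H 1 \<omega> powr - \<alpha>} \<le> prob {\<omega> \<in> space M. x \<le> inverse_process H s \<omega>}"
    unfolding prob_H_le[OF x s, symmetric]
    by (rule finite_measure_mono_AE, use AE_inverse_process[OF s] in eventually_elim) (use x in auto)
qed auto

text \<open>
  Write \<open>X = H 1 powr (- \<alpha>)\<close>. On the one hand \<open>n!\<close> is the integral of \<open>n * x ^ (n - 1) * exp (- x)\<close>, and
  \<open>exp (- x)\<close> is the Laplace transform of \<open>H 1\<close> at \<open>x powr (1 / \<alpha>)\<close>, that is, the mean of the integral
  of \<open>exp (- s)\<close> over \<open>s \<ge> x powr (1 / \<alpha>) * H 1\<close>. On the other hand this region is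
  \<open>x \<le> s powr \<alpha> * X\<close>, so integrating over \<open>x\<close> first leaves the mean of \<open>X ^ n\<close> times the integral of
  \<open>s powr (n * \<alpha>) * exp (- s)\<close>, a Gamma value.
\<close>

lemma moments_inverse:
  "(\<integral>\<^sup>+\<omega>. ennreal ((H 1 \<omega> powr (- \<alpha>)) ^ n) \<partial>M) = ennreal (fact n / Gamma (real n * \<alpha> + 1))"
proof (cases n)
  case 0
  thus ?thesis by (simp add: emeasure_space_1)
next
  case (Suc k)
  have n: "0 < n" by (simp add: Suc)
  have deriv: "DERIV (\<lambda>x. x ^ n) x :> real n * x ^ k" for x :: real
    using DERIV_pow[of n x] by (simp add: Suc)
  define X where "X \<omega> = H 1 \<omega> powr (- \<alpha>)" for \<omega>
  have [measurable]: "X \<in> borel_measurable M" unfolding X_def by measurable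
  let ?f = "\<lambda>x \<omega> s. ennreal (of_bool (0 < x \<and> 0 < s \<and> x powr (1 / \<alpha>) * H 1 \<omega> \<le> s) * (real n * x ^ k) * exp (- s))"
  interpret LM: pair_sigma_finite lborel M ..
  have tail: "(\<integral>\<^sup>+s. ennreal (of_bool (0 < s \<and> q \<le> s) * exp (- s)) \<partial>lborel) = ennreal (exp (- q))"
    if "0 \<le> q" for q :: real
  proof -
    have "((\<lambda>s. - exp (- s)) \<longlongrightarrow> (0 :: real)) at_top" by real_asymp
    hence "(\<integral>\<^sup>+s. ennreal (exp (- s)) * indicator {q..} s \<partial>lborel) = ennreal (0 - (- exp (- q)))"
      by (intro nn_integral_FTC_atLeast) (auto intro!: derivative_eq_intros)
    also have "(\<integral>\<^sup>+s. ennreal (exp (- s)) * indicator {q..} s \<partial>lborel) =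
        (\<integral>\<^sup>+s. ennreal (of_bool (0 < s \<and> q \<le> s) * exp (- s)) \<partial>lborel)"
      by (rule nn_integral_cong_AE) (use AE_lborel_singleton[of 0] that in \<open>auto elim!: eventually_mono simp: indicator_def\<close>)
    finally show ?thesis by simp
  qed
  have "ennreal (fact n) = ennreal (real n) * ennreal (fact k)"
    unfolding Suc fact_Suc by (rule ennreal_mult') simp
  also have "\<dots> = ennreal (real n) * (\<integral>\<^sup>+x. ennreal (x ^ k * exp (-x)) * indicator {0 ..} x \<partial>lborel)"
    unfolding nn_intergal_power_times_exp_Ici of_nat_fact ..
  also have "\<dots> = (\<integral>\<^sup>+x. ennreal (real n) * (ennreal (x ^ k * exp (-x)) * indicator {0 ..} x) \<partial>lborel)"
    by (rule nn_integral_cmult[symmetric]) measurable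
  also have "\<dots> = (\<integral>\<^sup>+x. \<integral>\<^sup>+\<omega>. \<integral>\<^sup>+s. ?f x \<omega> s \<partial>lborel \<partial>M \<partial>lborel)"
  proof (rule nn_integral_cong_AE)
    show "AE x in lborel. ennreal (real n) * (ennreal (x ^ k * exp (- x)) * indicator {0..} x) =
        (\<integral>\<^sup>+\<omega>. \<integral>\<^sup>+s. ?f x \<omega> s \<partial>lborel \<partial>M)"
      using AE_lborel_singleton[of 0]
    proof eventually_elim
      case (elim x)
      show ?case
      proof (cases "0 < x")
        case True
        have "(\<integral>\<^sup>+\<omega>. \<integral>\<^sup>+s. ?f x \<omega> s \<partial>lborel \<partial>M) =
            (\<integral>\<^sup>+\<omega>. ennreal (real n * x ^ k) * ennreal (exp (- (x powr (1 / \<alpha>) * H 1 \<omega>))) \<partial>M)"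
        proof (rule nn_integral_cong_AE)
          show "AE \<omega> in M. (\<integral>\<^sup>+s. ?f x \<omega> s \<partial>lborel) =
              ennreal (real n * x ^ k) * ennreal (exp (- (x powr (1 / \<alpha>) * H 1 \<omega>)))"
            using AE_H1_pos
          proof eventually_elim
            case (elim \<omega>)
            have "(\<integral>\<^sup>+s. ?f x \<omega> s \<partial>lborel) = (\<integral>\<^sup>+s. ennreal (real n * x ^ k) *
                ennreal (of_bool (0 < s \<and> x powr (1 / \<alpha>) * H 1 \<omega> \<le> s) * exp (- s)) \<partial>lborel)"
              using True by (intro nn_integral_cong) (auto simp flip: ennreal_mult')
            thus ?case
              using elim True by (simp add: nn_integral_cmult tail)
          qed
        qed
        also have "\<dots> = ennreal (real n * x ^ k) * (\<integral>\<^sup>+\<omega>. ennreal (exp (- (x powr (1 / \<alpha>) * H 1 \<omega>))) \<partial>M)"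
          by (rule nn_integral_cmult) measurable
        also have "(\<integral>\<^sup>+\<omega>. ennreal (exp (- (x powr (1 / \<alpha>) * H 1 \<omega>))) \<partial>M) = ennreal (exp (- x))"
          using laplace[of 1 "x powr (1 / \<alpha>)"] True index
          by (subst nn_integral_eq_integral) (auto intro!: integrable_laplace simp: powr_powr)
        finally show ?thesis using True
          by (simp add: mult.assoc flip: ennreal_mult')
      qed (use elim in simp)
    qed
  qed
  also have "\<dots> = (\<integral>\<^sup>+\<omega>. \<integral>\<^sup>+x. \<integral>\<^sup>+s. ?f x \<omega> s \<partial>lborel \<partial>lborel \<partial>M)"
    by (rule LM.Fubini'[symmetric]) measurable
  also have "\<dots> = (\<integral>\<^sup>+\<omega>. \<integral>\<^sup>+s. \<integral>\<^sup>+x. ?f x \<omega> s \<partial>lborel \<partial>lborel \<partial>M)"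
    by (rule nn_integral_cong, rule lborel_pair.Fubini') measurable
  also have "\<dots> = (\<integral>\<^sup>+\<omega>. ennreal (X \<omega> ^ n) * (\<integral>\<^sup>+s. ennreal (indicator {0..} s * s powr ((real n * \<alpha> + 1) - 1) / exp s) \<partial>lborel) \<partial>M)"
  proof (rule nn_integral_cong_AE)
    show "AE \<omega> in M. (\<integral>\<^sup>+s. \<integral>\<^sup>+x. ?f x \<omega> s \<partial>lborel \<partial>lborel) =
        ennreal (X \<omega> ^ n) * (\<integral>\<^sup>+s. ennreal (indicator {0..} s * s powr ((real n * \<alpha> + 1) - 1) / exp s) \<partial>lborel)"
      using AE_H1_pos
    proof eventually_elim
      case (elim \<omega>)
      have "(\<integral>\<^sup>+s. \<integral>\<^sup>+x. ?f x \<omega> s \<partial>lborel \<partial>lborel) =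
          (\<integral>\<^sup>+s. ennreal (X \<omega> ^ n) * ennreal (indicator {0..} s * s powr ((real n * \<alpha> + 1) - 1) / exp s) \<partial>lborel)"
      proof (rule nn_integral_cong_AE)
        show "AE s in lborel. (\<integral>\<^sup>+x. ?f x \<omega> s \<partial>lborel) =
            ennreal (X \<omega> ^ n) * ennreal (indicator {0..} s * s powr ((real n * \<alpha> + 1) - 1) / exp s)"
          using AE_lborel_singleton[of 0]
        proof eventually_elim
          case (elim s)
          show ?case
          proof (cases "0 < s")
            case True
            let ?v = "s powr \<alpha> * X \<omega>"
            have v: "0 \<le> ?v" by (simp add: X_def)
            have "(\<integral>\<^sup>+x. ?f x \<omega> s \<partial>lborel) =
                (\<integral>\<^sup>+x. ennreal (exp (- s)) * (ennreal (real n * x ^ k) * indicator {0..?v} x) \<partial>lborel)"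
            proof (rule nn_integral_cong_AE)
              show "AE x in lborel. ?f x \<omega> s =
                  ennreal (exp (- s)) * (ennreal (real n * x ^ k) * indicator {0..?v} x)"
                using AE_lborel_singleton[of 0]
              proof eventually_elim
                case (elim x)
                have "(0 < x \<and> 0 < s \<and> x powr (1 / \<alpha>) * H 1 \<omega> \<le> s) \<longleftrightarrow> x \<in> {0..?v}"
                  using elim True \<open>0 < H 1 \<omega>\<close> le_iff_inverse[of x s "H 1 \<omega>"] by (auto simp: X_def)
                thus ?case
                  by (subst ennreal_mult'[symmetric] | simp add: indicator_def mult_ac)+
              qed
            qed
            also have "\<dots> = ennreal (exp (- s)) * (\<integral>\<^sup>+x. ennreal (real n * x ^ k) * indicator {0..?v} x \<partial>lborel)"
              by (rule nn_integral_cmult) measurable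
            also have "(\<integral>\<^sup>+x. ennreal (real n * x ^ k) * indicator {0..?v} x \<partial>lborel) = ennreal (?v ^ n - 0 ^ n)"
              by (rule nn_integral_FTC_Icc[OF _ deriv _ v]) auto
            also have "?v ^ n - 0 ^ n = s powr (real n * \<alpha>) * X \<omega> ^ n"
              using True n by (simp add: power_mult_distrib powr_power zero_power)
            finally show ?thesis
              using True by (simp add: X_def exp_minus divide_inverse mult_ac flip: ennreal_mult')
          qed (use elim in simp)
        qed
      qed
      thus ?case by (simp add: nn_integral_cmult)
    qed
  qed
  also have "\<dots> = (\<integral>\<^sup>+\<omega>. ennreal (X \<omega> ^ n) \<partial>M) * ennreal (Gamma (real n * \<alpha> + 1))"
    using index by (subst Gamma_conv_nn_integral_real[symmetric]) (auto intro!: nn_integral_multc add_nonneg_pos)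
  finally have eq: "(\<integral>\<^sup>+\<omega>. ennreal (X \<omega> ^ n) \<partial>M) * ennreal (Gamma (real n * \<alpha> + 1)) = ennreal (fact n)" ..
  have G: "0 < Gamma (real n * \<alpha> + 1)"
    using index by (intro Gamma_real_pos add_nonneg_pos) auto
  have "(\<integral>\<^sup>+\<omega>. ennreal (X \<omega> ^ n) \<partial>M) =
      (\<integral>\<^sup>+\<omega>. ennreal (X \<omega> ^ n) \<partial>M) * ennreal (Gamma (real n * \<alpha> + 1)) / ennreal (Gamma (real n * \<alpha> + 1))"
    using G by (simp add: ennreal_mult_divide_eq ennreal_eq_0_iff)
  also have "\<dots> = ennreal (fact n / Gamma (real n * \<alpha> + 1))"
    unfolding eq using G by (simp add: divide_ennreal)
  finally show ?thesis by (simp add: X_def)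
qed

end

section \<open>Mittag-Leffler variables and the Caputo derivative\<close>

text \<open>
  The lower half of Stirling's formula up to exponential factors, from the part \<open>s \<ge> x\<close> of Euler's
  integral. Such factors are harmless, since only growth rates of \<open>n\<close>-th roots are compared.
\<close>

lemma powr_div_exp_le_Gamma:
  fixes x :: real
  assumes "0 < x" shows "(x / exp 1) powr x \<le> Gamma (x + 1)"
proof -
  have lim: "((\<lambda>s. - exp (- s)) \<longlongrightarrow> (0 :: real)) at_top" by real_asymp
  have "(x / exp 1) powr x = x powr x * exp (- x)"
    using assms by (simp add: powr_divide exp_powr_real exp_minus field_simps)
  hence "ennreal ((x / exp 1) powr x) = ennreal (x powr x) * ennreal (0 - (- exp (- x)))"
    by (simp add: ennreal_mult')
  also have "ennreal (0 - (- exp (- x))) = (\<integral>\<^sup>+s. ennreal (exp (- s)) * indicator {x..} s \<partial>lborel)"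
    by (rule nn_integral_FTC_atLeast[symmetric, OF _ _ _ lim]) (auto intro!: derivative_eq_intros)
  also have "ennreal (x powr x) * \<dots> = (\<integral>\<^sup>+s. ennreal (x powr x) * (ennreal (exp (- s)) * indicator {x..} s) \<partial>lborel)"
    by (rule nn_integral_cmult[symmetric]) measurable
  also have "\<dots> \<le> (\<integral>\<^sup>+s. ennreal (indicator {0..} s * s powr ((x + 1) - 1) / exp s) \<partial>lborel)"
    using assms
    by (intro nn_integral_mono)
       (auto simp: indicator_def exp_minus divide_inverse powr_mono2 mult_right_mono simp flip: ennreal_mult')
  also have "\<dots> = ennreal (Gamma (x + 1))"
    using assms by (intro Gamma_conv_nn_integral_real[symmetric]) auto
  finally show ?thesis using assms by (simp add: Gamma_real_pos less_imp_le)
qed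

text \<open>
  The upper half: one half of the exponential decay tames \<open>s powr x\<close>, the other half is integrated.
\<close>

lemma Gamma_le_powr_div_exp:
  fixes x :: real
  assumes "0 < x" shows "Gamma (x + 1) \<le> 2 * (2 * x / exp 1) powr x"
proof -
  have lim: "((\<lambda>s. - 2 * exp (- (s / 2))) \<longlongrightarrow> (0 :: real)) at_top" by real_asymp
  \<comment> \<open>The maximum of \<open>s powr x * exp (- s / 2)\<close> is attained at \<open>s = 2 * x\<close>.\<close>
  have peak: "s powr x / exp s \<le> (2 * x / exp 1) powr x * exp (- (s / 2))" if s: "0 < s" for s
  proof -
    have "ln (s / (2 * x)) \<le> s / (2 * x) - 1"
      using assms s by (intro ln_le_minus_one) auto
    hence "x * (ln s - ln (2 * x)) \<le> x * (s / (2 * x) - 1)"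
      using assms s by (intro mult_left_mono) (auto simp: ln_div)
    also have "\<dots> = s / 2 - x"
      using assms by (simp add: field_simps)
    finally have "x * ln s - s \<le> x * (ln (2 * x) - 1) - s / 2"
      by (simp add: algebra_simps)
    thus ?thesis
      using assms s by (simp add: powr_def ln_div flip: exp_diff exp_add)
  qed
  have "ennreal (Gamma (x + 1)) = (\<integral>\<^sup>+s. ennreal (indicator {0..} s * s powr ((x + 1) - 1) / exp s) \<partial>lborel)"
    using assms by (intro Gamma_conv_nn_integral_real) auto
  also have "\<dots> \<le> (\<integral>\<^sup>+s. ennreal ((2 * x / exp 1) powr x) * (ennreal (exp (- (s / 2))) * indicator {0..} s) \<partial>lborel)"
  proof (rule nn_integral_mono)
    fix s :: real
    show "ennreal (indicator {0..} s * s powr ((x + 1) - 1) / exp s) \<le>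
        ennreal ((2 * x / exp 1) powr x) * (ennreal (exp (- (s / 2))) * indicator {0..} s)"
      using peak[of s] by (cases "s = 0") (auto simp: indicator_def simp flip: ennreal_mult')
  qed
  also have "\<dots> = ennreal ((2 * x / exp 1) powr x) * (\<integral>\<^sup>+s. ennreal (exp (- (s / 2))) * indicator {0..} s \<partial>lborel)"
    by (rule nn_integral_cmult) measurable
  also have "(\<integral>\<^sup>+s. ennreal (exp (- (s / 2))) * indicator {0..} s \<partial>lborel) = ennreal (0 - (- 2 * exp (- (0 / 2))))"
    by (rule nn_integral_FTC_atLeast[OF _ _ _ lim]) (auto intro!: derivative_eq_intros)
  also have "ennreal ((2 * x / exp 1) powr x) * \<dots> = ennreal (2 * (2 * x / exp 1) powr x)"
    by (subst ennreal_mult'[symmetric]) (auto simp: mult_ac)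
  finally show ?thesis by (subst (asm) ennreal_le_iff) auto
qed

lemma summable_power_if_tendsto_0:
  fixes q :: "nat \<Rightarrow> real"
  assumes q: "q \<longlonglongrightarrow> 0" "\<And>n. 0 \<le> q n" and a: "\<forall>\<^sub>F n in sequentially. norm (a n :: real) \<le> q n ^ n"
  shows "summable a"
proof (rule summable_comparison_test_ev)
  have "\<forall>\<^sub>F n in sequentially. q n < 1 / 2"
    using q by (intro order_tendstoD) auto
  with a show "\<forall>\<^sub>F n in sequentially. norm (a n) \<le> (1 / 2) ^ n"
    by eventually_elim (meson less_imp_le order_trans power_mono q(2))
qed simp

lemma summable_mittag_leffler:
  fixes \<alpha> w :: real
  assumes "0 < \<alpha>" shows "summable (\<lambda>n. w ^ n / Gamma (real n * \<alpha> + 1))"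
proof (rule summable_power_if_tendsto_0)
  show "(\<lambda>n. \<bar>w\<bar> / (real n * \<alpha> / exp 1) powr \<alpha>) \<longlonglongrightarrow> 0"
    using assms by real_asymp
  show "\<forall>\<^sub>F n in sequentially. norm (w ^ n / Gamma (real n * \<alpha> + 1)) \<le> (\<bar>w\<bar> / (real n * \<alpha> / exp 1) powr \<alpha>) ^ n"
    using eventually_gt_at_top[of 0]
  proof eventually_elim
    case (elim n)
    have G: "0 < Gamma (real n * \<alpha> + 1)"
      using assms by (intro Gamma_real_pos add_nonneg_pos) auto
    have "norm (w ^ n / Gamma (real n * \<alpha> + 1)) = \<bar>w\<bar> ^ n / Gamma (real n * \<alpha> + 1)"
      using G by (simp add: abs_divide power_abs)
    also have "\<dots> \<le> \<bar>w\<bar> ^ n / (real n * \<alpha> / exp 1) powr (real n * \<alpha>)"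
      using assms elim by (intro divide_left_mono powr_div_exp_le_Gamma mult_pos_pos G) auto
    also have "(real n * \<alpha> / exp 1) powr (real n * \<alpha>) = ((real n * \<alpha> / exp 1) powr \<alpha>) ^ n"
      using assms elim by (simp add: powr_power)
    finally show ?case by (simp add: power_divide)
  qed
qed simp

text \<open>
  The law is described through its moments; its moment generating function is then the Mittag-Leffler
  function, an entire function. Nonnegativity is required everywhere, which the version
  \<open>H 1 powr (- \<alpha>)\<close> provides.
\<close>

locale mittag_leffler = prob_space A for A :: "'a measure" +
  fixes \<alpha> :: real and X :: "'a \<Rightarrow> real"
  assumes index: "0 < \<alpha>" "\<alpha> < 1"
    and measurable_X [measurable]: "X \<in> borel_measurable A"
    and nonneg: "0 \<le> X \<omega>"
    and moments: "(\<integral>\<^sup>+\<omega>. ennreal (X \<omega> ^ n) \<partial>A) = ennreal (fact n / Gamma (real n * \<alpha> + 1))"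
begin

lemma Gamma_pos: "0 < Gamma (real n * \<alpha> + 1)"
  using index by (intro Gamma_real_pos add_nonneg_pos) auto

lemma nn_integral_exp_finite:
  assumes "0 \<le> w" shows "(\<integral>\<^sup>+\<omega>. ennreal (exp (w * X \<omega>)) \<partial>A) < \<infinity>"
proof -
  have "(\<integral>\<^sup>+\<omega>. ennreal (exp (w * X \<omega>)) \<partial>A) = (\<Sum>n. ennreal (w ^ n / Gamma (real n * \<alpha> + 1)))"
    using assms nonneg Gamma_pos
    by (subst nn_integral_exp_eq_series) (auto simp: moments ennreal_mult'[symmetric] intro!: suminf_cong)
  also have "\<dots> < \<infinity>"
    using assms Gamma_pos[THEN less_imp_le]
    by (subst suminf_ennreal2) (auto intro!: summable_mittag_leffler index divide_nonneg_nonneg)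
  finally show ?thesis .
qed

lemma integrable_power_exp: "integrable A (\<lambda>\<omega>. X \<omega> ^ j * exp (w * X \<omega>))"
proof (rule Bochner_Integration.integrable_bound)
  show "integrable A (\<lambda>\<omega>. fact j * exp ((1 + \<bar>w\<bar>) * X \<omega>))"
    using nn_integral_exp_finite[of "1 + \<bar>w\<bar>"]
    by (intro integrable_mult_right integrableI_nonneg) auto
  show "AE \<omega> in A. norm (X \<omega> ^ j * exp (w * X \<omega>)) \<le> norm (fact j * exp ((1 + \<bar>w\<bar>) * X \<omega>))"
  proof (rule AE_I2)
    fix \<omega>
    have "X \<omega> ^ j * exp (w * X \<omega>) \<le> (fact j * exp (X \<omega>)) * exp (\<bar>w\<bar> * X \<omega>)"
      using nonneg by (intro mult_mono power_le_fact_mult_exp) (auto intro!: mult_right_mono)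
    thus "norm (X \<omega> ^ j * exp (w * X \<omega>)) \<le> norm (fact j * exp ((1 + \<bar>w\<bar>) * X \<omega>))"
      using nonneg by (simp add: abs_mult distrib_right mult.assoc exp_add)
  qed
qed measurable

lemma integrable_power: "integrable A (\<lambda>\<omega>. X \<omega> ^ j)"
  using integrable_power_exp[of j 0] by simp

end

text \<open>
  The weight that differentiating \<open>\<Phi> (r powr \<alpha>)\<close> in \<open>r\<close> produces inside the Caputo derivative at \<open>s\<close>:
  the inner derivative \<open>\<alpha> * r powr (\<alpha> - 1)\<close> times the singular kernel with its normalisation.
\<close>

definition caputo_kernel :: "real \<Rightarrow> real \<Rightarrow> real \<Rightarrow> real" where
  "caputo_kernel \<alpha> s r = (if 0 < r \<and> r < s then \<alpha> * r powr (\<alpha> - 1) * (s - r) powr (- \<alpha>) / Gamma (1 - \<alpha>) else 0)"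

lemma measurable_caputo_kernel [measurable]: "caputo_kernel \<alpha> s \<in> borel_measurable borel"
  unfolding caputo_kernel_def by measurable

lemma caputo_kernel_nonneg: "0 < \<alpha> \<Longrightarrow> \<alpha> < 1 \<Longrightarrow> 0 \<le> caputo_kernel \<alpha> s r"
  using Gamma_real_pos[of "1 - \<alpha>"] by (simp add: caputo_kernel_def)

text \<open>
  After rescaling to the unit interval this is Euler's Beta integral.
\<close>

lemma nn_integral_caputo_kernel:
  assumes \<alpha>: "0 < \<alpha>" "\<alpha> < 1" and s: "0 < s"
  shows "(\<integral>\<^sup>+r. ennreal (caputo_kernel \<alpha> s r * (r powr \<alpha>) ^ n) \<partial>lborel) =
    ennreal ((s powr \<alpha>) ^ n * \<alpha> * Gamma (real (Suc n) * \<alpha>) / Gamma (real n * \<alpha> + 1))"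
proof -
  let ?a = "real (Suc n) * \<alpha>" and ?b = "1 - \<alpha>"
  let ?K = "\<alpha> * s powr (real n * \<alpha>) / (s * Gamma (1 - \<alpha>))"
  have ab: "0 < ?a" "0 < ?b" using \<alpha> by auto
  have G: "0 < Gamma (1 - \<alpha>)" using \<alpha> by (intro Gamma_real_pos) auto
  have K: "0 \<le> ?K" using G \<alpha> s by simp
  have "(\<integral>\<^sup>+r. ennreal (caputo_kernel \<alpha> s r * (r powr \<alpha>) ^ n) \<partial>lborel) =
      ennreal \<bar>s\<bar> * (\<integral>\<^sup>+r. ennreal (caputo_kernel \<alpha> s (0 + s * r) * ((0 + s * r) powr \<alpha>) ^ n) \<partial>lborel)"
    using s by (intro nn_integral_real_affine) auto
  also have "(\<integral>\<^sup>+r. ennreal (caputo_kernel \<alpha> s (0 + s * r) * ((0 + s * r) powr \<alpha>) ^ n) \<partial>lborel) =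
      (\<integral>\<^sup>+r. ennreal ?K * ennreal (indicator {0..1} r * (r powr (?a - 1) * (1 - r) powr (?b - 1))) \<partial>lborel)"
  proof (rule nn_integral_cong_AE)
    show "AE r in lborel. ennreal (caputo_kernel \<alpha> s (0 + s * r) * ((0 + s * r) powr \<alpha>) ^ n) =
        ennreal ?K * ennreal (indicator {0..1} r * (r powr (?a - 1) * (1 - r) powr (?b - 1)))"
      using AE_lborel_singleton[of 0] AE_lborel_singleton[of 1]
    proof eventually_elim
      case (elim r)
      show ?case
      proof (cases "0 < r \<and> r < 1")
        case True
        have "s - s * r = s * (1 - r)" by (simp add: algebra_simps)
        hence "caputo_kernel \<alpha> s (s * r) * ((s * r) powr \<alpha>) ^ n =
            \<alpha> * ((s * r) powr (\<alpha> - 1) * (s * (1 - r)) powr (- \<alpha>) * (s * r) powr (real n * \<alpha>)) / Gamma (1 - \<alpha>)"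
          using True s by (simp add: caputo_kernel_def powr_power)
        also have "(s * r) powr (\<alpha> - 1) * (s * (1 - r)) powr (- \<alpha>) * (s * r) powr (real n * \<alpha>) =
            (s powr (\<alpha> - 1) * s powr (- \<alpha>) * s powr (real n * \<alpha>)) * ((r powr (\<alpha> - 1) * r powr (real n * \<alpha>)) * (1 - r) powr (- \<alpha>))"
          using True s by (simp add: powr_mult)
        also have "s powr (\<alpha> - 1) * s powr (- \<alpha>) * s powr (real n * \<alpha>) = s powr (real n * \<alpha>) / s"
        proof -
          have "s powr (\<alpha> - 1) * s powr (- \<alpha>) * s powr (real n * \<alpha>) = s powr (((\<alpha> - 1) + (- \<alpha>)) + real n * \<alpha>)"
            by (simp only: powr_add)
          also have "((\<alpha> - 1) + (- \<alpha>)) + real n * \<alpha> = real n * \<alpha> - 1" by simp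
          finally show ?thesis using s by (simp add: powr_diff)
        qed
        also have "r powr (\<alpha> - 1) * r powr (real n * \<alpha>) = r powr (?a - 1)"
          by (simp add: algebra_simps flip: powr_add)
        finally show ?thesis
          using True K by (simp add: mult_ac flip: ennreal_mult')
      qed (use elim s in \<open>auto simp: caputo_kernel_def mult_less_cancel_left2 zero_less_mult_iff\<close>)
    qed
  qed
  also have "\<dots> = ennreal ?K * (\<integral>\<^sup>+r. ennreal (indicator {0..1} r * (r powr (?a - 1) * (1 - r) powr (?b - 1))) \<partial>lborel)"
    by (rule nn_integral_cmult) measurable
  also have "(\<integral>\<^sup>+r. ennreal (indicator {0..1} r * (r powr (?a - 1) * (1 - r) powr (?b - 1))) \<partial>lborel) = ennreal (Beta ?a ?b)"
    by (rule nn_integral_has_integral_lebesgue[OF _ has_integral_Beta_real[OF ab]]) auto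
  also have "ennreal \<bar>s\<bar> * (ennreal ?K * ennreal (Beta ?a ?b)) = ennreal (s * (?K * Beta ?a ?b))"
    using s K by (simp only: ennreal_mult' abs_of_pos less_imp_le)
  also have "s * (?K * Beta ?a ?b) = s powr (real n * \<alpha>) * \<alpha> * Gamma (real (Suc n) * \<alpha>) / Gamma (real n * \<alpha> + 1)"
  proof -
    have "Gamma (?a + ?b) = Gamma (real n * \<alpha> + 1)"
      by (rule arg_cong[where f=Gamma]) (simp add: algebra_simps)
    thus ?thesis unfolding Beta_def using s G by (simp del: of_nat_Suc)
  qed
  also have "s powr (real n * \<alpha>) = (s powr \<alpha>) ^ n"
    using s by (simp add: powr_power)
  finally show ?thesis .
qed

text \<open>
  The Caputo rule in the form of an equality of laws. For \<open>f (x) = x ^ n\<close> it is the identity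
  \<open>Gamma (x + 1) = x * Gamma x\<close> at \<open>x = (n + 1) * \<alpha>\<close>, which links the moments of order \<open>n + 1\<close> and
  \<open>n\<close>; the general case follows since the law on the right is determined by its moments.
\<close>

lemma (in mittag_leffler) nn_integral_caputo_kernel_law:
  assumes s: "0 < s" and [measurable]: "f \<in> borel_measurable borel"
  shows "(\<integral>\<^sup>+r. \<integral>\<^sup>+\<omega>. ennreal (caputo_kernel \<alpha> s r * X \<omega>) * f (r powr \<alpha> * X \<omega>) \<partial>A \<partial>lborel) =
    (\<integral>\<^sup>+\<omega>. f (s powr \<alpha> * X \<omega>) \<partial>A)"
proof -
  let ?D = "density (lborel \<Otimes>\<^sub>M A) (\<lambda>p. ennreal (caputo_kernel \<alpha> s (fst p) * X (snd p)))"
  let ?Z = "\<lambda>p. fst p powr \<alpha> * X (snd p)" and ?W = "\<lambda>\<omega>. s powr \<alpha> * X \<omega>"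
  have split: "(\<integral>\<^sup>+p. g (?Z p) \<partial>?D) =
      (\<integral>\<^sup>+r. \<integral>\<^sup>+\<omega>. ennreal (caputo_kernel \<alpha> s r * X \<omega>) * g (r powr \<alpha> * X \<omega>) \<partial>A \<partial>lborel)"
    if [measurable]: "g \<in> borel_measurable borel" for g :: "real \<Rightarrow> ennreal"
    by (simp add: nn_integral_density nn_integral_fst[symmetric])
  have "distr ?D borel ?Z = distr A borel ?W"
  proof (rule distr_eq_if_nn_moments_eq)
    show "prob_space A" by (rule prob_space_axioms)
    show "0 \<le> ?Z p" "0 \<le> ?W \<omega>" for p \<omega> using nonneg by simp_all
    show "(\<integral>\<^sup>+\<omega>. ennreal (exp (r * ?W \<omega>)) \<partial>A) < \<infinity>" if "0 \<le> r" for r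
      using nn_integral_exp_finite[of "r * s powr \<alpha>"] that by (simp add: mult.assoc)
    show "(\<integral>\<^sup>+p. ennreal (?Z p ^ n) \<partial>?D) = (\<integral>\<^sup>+\<omega>. ennreal (?W \<omega> ^ n) \<partial>A)" for n
    proof -
      have "(\<integral>\<^sup>+p. ennreal (?Z p ^ n) \<partial>?D) =
          (\<integral>\<^sup>+r. \<integral>\<^sup>+\<omega>. ennreal (caputo_kernel \<alpha> s r * X \<omega>) * ennreal ((r powr \<alpha> * X \<omega>) ^ n) \<partial>A \<partial>lborel)"
        by (rule split) measurable
      also have "\<dots> = (\<integral>\<^sup>+r. \<integral>\<^sup>+\<omega>. ennreal (caputo_kernel \<alpha> s r * (r powr \<alpha>) ^ n) * ennreal (X \<omega> ^ Suc n) \<partial>A \<partial>lborel)"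
        using nonneg caputo_kernel_nonneg[OF index]
        by (intro nn_integral_cong) (simp add: power_mult_distrib mult_ac flip: ennreal_mult')
      also have "\<dots> = (\<integral>\<^sup>+r. ennreal (caputo_kernel \<alpha> s r * (r powr \<alpha>) ^ n) \<partial>lborel) * (\<integral>\<^sup>+\<omega>. ennreal (X \<omega> ^ Suc n) \<partial>A)"
        by (simp add: nn_integral_cmult nn_integral_multc del: power_Suc)
      also have "\<dots> = ennreal ((s powr \<alpha>) ^ n * \<alpha> * Gamma (real (Suc n) * \<alpha>) / Gamma (real n * \<alpha> + 1)) *
          ennreal (fact (Suc n) / Gamma (real (Suc n) * \<alpha> + 1))"
        by (simp only: nn_integral_caputo_kernel[OF index s] moments)
      also have "\<dots> = ennreal ((s powr \<alpha>) ^ n * (fact n / Gamma (real n * \<alpha> + 1)))"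
      proof -
        have a: "0 < real (Suc n) * \<alpha>" using index by simp
        have "Gamma (real (Suc n) * \<alpha> + 1) = real (Suc n) * \<alpha> * Gamma (real (Suc n) * \<alpha>)"
          using a by (intro Gamma_plus1) (auto simp: nonpos_Ints_def)
        moreover have "Gamma (real (Suc n) * \<alpha>) \<noteq> 0" using Gamma_real_pos[OF a] by (rule less_imp_neq[symmetric])
        ultimately have "(s powr \<alpha>) ^ n * \<alpha> * Gamma (real (Suc n) * \<alpha>) / Gamma (real n * \<alpha> + 1) *
            (fact (Suc n) / Gamma (real (Suc n) * \<alpha> + 1)) = (s powr \<alpha>) ^ n * (fact n / Gamma (real n * \<alpha> + 1))"
          using index by (simp add: fact_Suc field_simps del: of_nat_Suc)
        thus ?thesis
          using Gamma_pos[of n] a index by (subst ennreal_mult'[symmetric]) (auto intro!: divide_nonneg_pos mult_nonneg_nonneg less_imp_le[OF Gamma_real_pos])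
      qed
      also have "\<dots> = ennreal ((s powr \<alpha>) ^ n) * (\<integral>\<^sup>+\<omega>. ennreal (X \<omega> ^ n) \<partial>A)"
        unfolding moments by (rule ennreal_mult') simp
      also have "\<dots> = (\<integral>\<^sup>+\<omega>. ennreal (?W \<omega> ^ n) \<partial>A)"
        by (subst nn_integral_cmult[symmetric]) (auto simp: power_mult_distrib ennreal_mult')
      finally show ?thesis .
    qed
  qed measurable
  hence "(\<integral>\<^sup>+x. f x \<partial>distr ?D borel ?Z) = (\<integral>\<^sup>+x. f x \<partial>distr A borel ?W)" by simp
  thus ?thesis by (simp add: nn_integral_distr split)
qed

locale mittag_leffler_times = mittag_leffler A \<alpha> X + B: prob_space B
  for A :: "'a measure" and \<alpha> X and B :: "'b measure"
begin

sublocale P: pair_prob_space A B ..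

lemma distr_caputo_kernel:
  assumes s: "0 < s"
  shows "distr (density (lborel \<Otimes>\<^sub>M (A \<Otimes>\<^sub>M B)) (\<lambda>p. ennreal (caputo_kernel \<alpha> s (fst p) * X (fst (snd p)))))
      (borel \<Otimes>\<^sub>M B) (\<lambda>p. (fst p powr \<alpha> * X (fst (snd p)), snd (snd p))) =
    distr (A \<Otimes>\<^sub>M B) (borel \<Otimes>\<^sub>M B) (\<lambda>p. (s powr \<alpha> * X (fst p), snd p))"
    (is "distr ?D ?N ?g = distr _ _ ?g'")
proof (rule measure_eqI)
  fix S assume "S \<in> sets (distr ?D ?N ?g)"
  hence S [measurable]: "S \<in> sets ?N" by simp
  define F where "F v = (\<integral>\<^sup>+b. indicator S (v, b) \<partial>B)" for v :: real
  have [measurable]: "F \<in> borel_measurable borel" unfolding F_def by measurable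
  have "emeasure (distr ?D ?N ?g) S = (\<integral>\<^sup>+x. indicator S x \<partial>distr ?D ?N ?g)" by simp
  also have "\<dots> = (\<integral>\<^sup>+p. indicator S (?g p) \<partial>?D)"
    by (rule nn_integral_distr) measurable
  also have "\<dots> = (\<integral>\<^sup>+p. ennreal (caputo_kernel \<alpha> s (fst p) * X (fst (snd p))) * indicator S (?g p) \<partial>(lborel \<Otimes>\<^sub>M (A \<Otimes>\<^sub>M B)))"
    by (rule nn_integral_density) measurable
  also have "\<dots> = (\<integral>\<^sup>+r. \<integral>\<^sup>+q. ennreal (caputo_kernel \<alpha> s r * X (fst q)) *
      indicator S (r powr \<alpha> * X (fst q), snd q) \<partial>(A \<Otimes>\<^sub>M B) \<partial>lborel)"
    by (rule P.nn_integral_fst[of "\<lambda>p. ennreal (caputo_kernel \<alpha> s (fst p) * X (fst (snd p))) *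
      indicator S (?g p)" lborel, symmetric, unfolded fst_conv snd_conv]) measurable
  also have "\<dots> = (\<integral>\<^sup>+r. \<integral>\<^sup>+a. \<integral>\<^sup>+b. ennreal (caputo_kernel \<alpha> s r * X a) * indicator S (r powr \<alpha> * X a, b) \<partial>B \<partial>A \<partial>lborel)"
    by (intro nn_integral_cong B.nn_integral_fst[of "\<lambda>q. ennreal (caputo_kernel \<alpha> s r * X (fst q)) *
      indicator S (r powr \<alpha> * X (fst q), snd q)" A for r, symmetric, unfolded fst_conv snd_conv]) measurable
  also have "\<dots> = (\<integral>\<^sup>+r. \<integral>\<^sup>+a. ennreal (caputo_kernel \<alpha> s r * X a) * F (r powr \<alpha> * X a) \<partial>A \<partial>lborel)"
    unfolding F_def by (intro nn_integral_cong nn_integral_cmult) measurable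
  also have "\<dots> = (\<integral>\<^sup>+a. F (s powr \<alpha> * X a) \<partial>A)"
    by (rule nn_integral_caputo_kernel_law[OF s]) measurable
  also have "\<dots> = (\<integral>\<^sup>+p. indicator S (?g' p) \<partial>(A \<Otimes>\<^sub>M B))"
    unfolding F_def
    by (rule B.nn_integral_fst[of "\<lambda>p. indicator S (?g' p)" A, unfolded fst_conv snd_conv]) measurable
  also have "\<dots> = (\<integral>\<^sup>+x. indicator S x \<partial>distr (A \<Otimes>\<^sub>M B) ?N ?g')"
    by (rule nn_integral_distr[symmetric]) measurable
  also have "\<dots> = emeasure (distr (A \<Otimes>\<^sub>M B) ?N ?g') S" by simp
  finally show "emeasure (distr ?D ?N ?g) S = emeasure (distr (A \<Otimes>\<^sub>M B) ?N ?g') S" .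
qed simp

text \<open>
  If \<open>f \<sigma> = E (g (\<sigma> powr \<alpha> * X, \<omega>))\<close> with an independent \<open>\<omega>\<close>, then the hypothesis on the derivative is
  differentiation under the integral sign for \<open>h\<close> the partial derivative of \<open>g\<close>. Only integrability
  at the end point \<open>s\<close> is needed, because integrability with respect to the Caputo kernel is
  integrability under an equal law.
\<close>

lemma caputo_if_kernel_derivative:
  fixes h :: "real \<times> 'b \<Rightarrow> real"
  assumes s: "0 < s" and [measurable]: "h \<in> borel_measurable (borel \<Otimes>\<^sub>M B)"
    and int: "integrable (A \<Otimes>\<^sub>M B) (\<lambda>p. h (s powr \<alpha> * X (fst p), snd p))"
    and deriv: "\<And>r. 0 < r \<Longrightarrow> r < s \<Longrightarrow> (f has_real_derivative
      \<alpha> * r powr (\<alpha> - 1) * (LINT p|(A \<Otimes>\<^sub>M B). X (fst p) * h (r powr \<alpha> * X (fst p), snd p))) (at r)"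
  shows "caputo_differentiable \<alpha> f s"
    and "caputo_deriv \<alpha> f s = (LINT p|(A \<Otimes>\<^sub>M B). h (s powr \<alpha> * X (fst p), snd p))"
proof -
  let ?w = "\<lambda>p. caputo_kernel \<alpha> s (fst p) * X (fst (snd p))"
  let ?D = "density (lborel \<Otimes>\<^sub>M (A \<Otimes>\<^sub>M B)) (\<lambda>p. ennreal (?w p))"
  let ?N = "borel \<Otimes>\<^sub>M B"
  let ?g = "\<lambda>p. (fst p powr \<alpha> * X (fst (snd p)), snd (snd p))"
  let ?g' = "\<lambda>p. (s powr \<alpha> * X (fst p), snd p)"
  let ?I = "\<lambda>r. LINT p|(A \<Otimes>\<^sub>M B). X (fst p) * h (r powr \<alpha> * X (fst p), snd p)"
  interpret LP: pair_sigma_finite lborel "A \<Otimes>\<^sub>M B" ..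
  have w: "0 \<le> ?w p" for p
    using nonneg caputo_kernel_nonneg[OF index] by simp
  have [measurable]: "?g \<in> measurable ?D ?N" "?g' \<in> measurable (A \<Otimes>\<^sub>M B) ?N" by measurable
  have "integrable (distr (A \<Otimes>\<^sub>M B) ?N ?g') h"
    using int by (subst integrable_distr_eq) auto
  hence "integrable ?D (\<lambda>p. h (?g p))"
    unfolding distr_caputo_kernel[OF s, symmetric] by (subst (asm) integrable_distr_eq) auto
  hence int': "integrable (lborel \<Otimes>\<^sub>M (A \<Otimes>\<^sub>M B)) (\<lambda>p. ?w p * h (?g p))"
    using w by (subst (asm) integrable_density) auto
  have "(LINT p|(A \<Otimes>\<^sub>M B). h (?g' p)) = (LINT x|distr ?D ?N ?g. h x)"
    unfolding distr_caputo_kernel[OF s] by (rule integral_distr[symmetric]) measurable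
  also have "\<dots> = (LINT p|?D. h (?g p))"
    by (rule integral_distr) measurable
  also have "\<dots> = (LINT p|(lborel \<Otimes>\<^sub>M (A \<Otimes>\<^sub>M B)). ?w p * h (?g p))"
    using w by (subst integral_density) auto
  also have "\<dots> = (LINT r|lborel. LINT q|(A \<Otimes>\<^sub>M B). ?w (r, q) * h (?g (r, q)))"
    by (rule LP.integral_fst'[OF int', symmetric])
  finally have eq: "(LINT p|(A \<Otimes>\<^sub>M B). h (?g' p)) = (LINT r|lborel. caputo_kernel \<alpha> s r * ?I r)"
    by (simp add: mult.assoc)
  have int_r: "integrable lborel (\<lambda>r. caputo_kernel \<alpha> s r * ?I r)"
    using LP.integrable_fst'[OF int'] by (simp add: mult.assoc)
  have G: "0 < Gamma (1 - \<alpha>)" using index by (intro Gamma_real_pos) auto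
  have integrand: "indicator {0<..<s} r *\<^sub>R (deriv f r / (s - r) powr \<alpha>) = Gamma (1 - \<alpha>) * (caputo_kernel \<alpha> s r * ?I r)" for r
  proof (cases "0 < r \<and> r < s")
    case True
    hence "deriv f r = \<alpha> * r powr (\<alpha> - 1) * ?I r"
      using deriv[of r] by (intro DERIV_imp_deriv) auto
    thus ?thesis using True G by (simp add: caputo_kernel_def powr_minus divide_inverse)
  qed (auto simp: caputo_kernel_def)
  have "f differentiable (at r)" if "0 < r" "r < s" for r
    using deriv[OF that] unfolding real_differentiable_def by blast
  thus "caputo_differentiable \<alpha> f s"
    unfolding caputo_differentiable_def set_integrable_def integrand using int_r by auto
  show "caputo_deriv \<alpha> f s = (LINT p|(A \<Otimes>\<^sub>M B). h (s powr \<alpha> * X (fst p), snd p))"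
    unfolding caputo_deriv_def set_lebesgue_integral_def integrand eq using G by simp
qed

end

section \<open>Exponential moments of a product of Mittag-Leffler variables\<close>

text \<open>
  The coefficient of \<open>z ^ n\<close> in the mean of \<open>exp (z * X * Y)\<close> for independent Mittag-Leffler variables:
  two factors \<open>n!\<close> from the moments, divided by the \<open>n!\<close> of the exponential series.
\<close>

definition stable_product_coeff :: "real \<Rightarrow> real \<Rightarrow> nat \<Rightarrow> real" where
  "stable_product_coeff \<alpha> \<beta> n = fact n / (Gamma (real n * \<alpha> + 1) * Gamma (real n * \<beta> + 1))"

lemma stable_product_coeff_pos:
  "0 < \<alpha> \<Longrightarrow> 0 < \<beta> \<Longrightarrow> 0 < stable_product_coeff \<alpha> \<beta> n"
  unfolding stable_product_coeff_def
  by (intro divide_pos_pos mult_pos_pos Gamma_real_pos add_nonneg_pos) auto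

lemma summable_stable_product_if_sum_gt_1:
  assumes ab: "0 < \<alpha>" "0 < \<beta>" "1 < \<alpha> + \<beta>" and z: "0 \<le> z"
  shows "summable (\<lambda>n. stable_product_coeff \<alpha> \<beta> n * z ^ n)"
proof (rule summable_power_if_tendsto_0)
  let ?K = "z / ((\<alpha> / exp 1) powr \<alpha> * (\<beta> / exp 1) powr \<beta>)"
  let ?q = "\<lambda>n. ?K * real n powr (1 - (\<alpha> + \<beta>))"
  have "(\<lambda>n. real n powr d) \<longlonglongrightarrow> 0" if "d < 0" for d :: real
    using that by (intro tendsto_neg_powr filterlim_real_sequentially) auto
  hence "?q \<longlonglongrightarrow> ?K * 0"
    using ab by (intro tendsto_mult_left) auto
  thus "?q \<longlonglongrightarrow> 0" by simp
  show "0 \<le> ?q n" for n using z ab by simp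
  show "\<forall>\<^sub>F n in sequentially. norm (stable_product_coeff \<alpha> \<beta> n * z ^ n) \<le> ?q n ^ n"
    using eventually_gt_at_top[of 0]
  proof eventually_elim
    case (elim n)
    note [simp] = Gamma_real_pos[THEN less_imp_le]
    have G: "0 < Gamma (real n * \<alpha> + 1)" "0 < Gamma (real n * \<beta> + 1)"
      using ab by (auto intro!: Gamma_real_pos add_nonneg_pos)
    have pow: "(real n * \<gamma> / exp 1) powr (real n * \<gamma>) = (real n powr \<gamma> * (\<gamma> / exp 1) powr \<gamma>) ^ n" if "0 < \<gamma>" for \<gamma>
      using that elim by (simp add: powr_power flip: powr_mult)
    have ratio: "real n powr (1 - (\<alpha> + \<beta>)) = real n / (real n powr \<alpha> * real n powr \<beta>)"
      using elim by (simp add: powr_diff powr_add)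
    have "fact n \<le> real n ^ n"
      using fact_le_power[of n, where 'a=real] by simp
    hence "stable_product_coeff \<alpha> \<beta> n * z ^ n \<le>
        real n ^ n / ((real n * \<alpha> / exp 1) powr (real n * \<alpha>) * (real n * \<beta> / exp 1) powr (real n * \<beta>)) * z ^ n"
      unfolding stable_product_coeff_def using ab elim z G
      by (intro mult_right_mono frac_le mult_mono powr_div_exp_le_Gamma) (auto intro: mult_pos_pos)
    also have "\<dots> = (real n / ((real n powr \<alpha> * (\<alpha> / exp 1) powr \<alpha>) * (real n powr \<beta> * (\<beta> / exp 1) powr \<beta>)) * z) ^ n"
      using ab by (simp only: pow power_mult_distrib power_divide)
    also have "real n / ((real n powr \<alpha> * (\<alpha> / exp 1) powr \<alpha>) * (real n powr \<beta> * (\<beta> / exp 1) powr \<beta>)) * z = ?q n"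
      using ratio by (simp add: field_simps)
    finally show ?case
      using stable_product_coeff_pos[OF ab(1,2), of n] z by simp
  qed
qed

lemma not_summable_stable_product_if_sum_lt_1:
  assumes ab: "0 < \<alpha>" "0 < \<beta>" "\<alpha> + \<beta> < 1" and z: "0 < z"
  shows "\<not> summable (\<lambda>n. stable_product_coeff \<alpha> \<beta> n * z ^ n)"
proof
  assume "summable (\<lambda>n. stable_product_coeff \<alpha> \<beta> n * z ^ n)"
  hence "(\<lambda>n. stable_product_coeff \<alpha> \<beta> n * z ^ n) \<longlonglongrightarrow> 0" by (rule summable_LIMSEQ_zero)
  hence small: "\<forall>\<^sub>F n in sequentially. stable_product_coeff \<alpha> \<beta> n * z ^ n < 1 / 4"
    by (rule order_tendstoD) simp
  let ?K = "z / (exp 1 * ((2 * \<alpha> / exp 1) powr \<alpha> * (2 * \<beta> / exp 1) powr \<beta>))"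
  let ?q = "\<lambda>n. ?K * real n powr (1 - (\<alpha> + \<beta>))"
  have K: "0 < ?K" using z ab by simp
  have "filterlim (\<lambda>n. real n powr d) at_top sequentially" if "0 < d" for d
    using that by real_asymp
  hence "filterlim ?q at_top sequentially"
    using ab by (intro filterlim_tendsto_pos_mult_at_top[OF tendsto_const K]) auto
  hence "\<forall>\<^sub>F n in sequentially. 1 \<le> ?q n" by (simp add: filterlim_at_top)
  with small have "\<forall>\<^sub>F n::nat in sequentially. False"
    using eventually_gt_at_top[of 0]
  proof eventually_elim
    case (elim n)
    have G: "0 < Gamma (real n * \<alpha> + 1)" "0 < Gamma (real n * \<beta> + 1)"
      using ab by (auto intro!: Gamma_real_pos add_nonneg_pos)
    have pow: "(2 * (real n * \<gamma>) / exp 1) powr (real n * \<gamma>) = (real n powr \<gamma> * (2 * \<gamma> / exp 1) powr \<gamma>) ^ n" if "0 < \<gamma>" for \<gamma>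
      using that elim by (simp add: powr_power mult_ac flip: powr_mult)
    have ratio: "real n powr (1 - (\<alpha> + \<beta>)) = real n / (real n powr \<alpha> * real n powr \<beta>)"
      using elim by (simp add: powr_diff powr_add)
    have n_pow: "(real n / exp 1) powr real n = (real n / exp 1) ^ n"
      using elim by (intro powr_realpow) auto
    have n_fact: "(real n / exp 1) ^ n \<le> fact n"
      using powr_div_exp_le_Gamma[of "real n"] elim by (simp add: n_pow add.commute Gamma_fact)
    have "1 / 4 \<le> ?q n ^ n / 4" using elim by simp
    also have "?q n = real n / exp 1 / ((real n powr \<alpha> * (2 * \<alpha> / exp 1) powr \<alpha>) * (real n powr \<beta> * (2 * \<beta> / exp 1) powr \<beta>)) * z"
      using ratio by (simp add: field_simps)
    also have "\<dots> ^ n / 4 = (real n / exp 1) ^ n / ((2 * (2 * (real n * \<alpha>) / exp 1) powr (real n * \<alpha>)) *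
        (2 * (2 * (real n * \<beta>) / exp 1) powr (real n * \<beta>))) * z ^ n"
      using ab by (simp add: pow power_mult_distrib power_divide)
    also have "\<dots> \<le> stable_product_coeff \<alpha> \<beta> n * z ^ n"
      unfolding stable_product_coeff_def using ab elim z G n_fact
      by (intro mult_right_mono frac_le mult_mono Gamma_le_powr_div_exp) (auto intro: mult_pos_pos less_imp_le)
    finally show ?case using elim by simp
  qed
  thus False by simp
qed

text \<open>
  The Beta integral is the \<open>n\<close>-th moment of \<open>h x = x powr \<alpha> * (1 - x) powr (1 - \<alpha>)\<close> on the unit
  interval. This makes the radius of convergence the maximum of \<open>h\<close> and shows that the series diverges
  at the radius, like the harmonic series.
\<close>

lemma stable_product_coeff_eq_Beta:
  assumes "0 < \<alpha>" "\<alpha> < 1"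
  shows "stable_product_coeff \<alpha> (1 - \<alpha>) n = 1 / (real (Suc n) * Beta (real n * \<alpha> + 1) (real n * (1 - \<alpha>) + 1))"
proof -
  have "Gamma ((real n * \<alpha> + 1) + (real n * (1 - \<alpha>) + 1)) = Gamma (1 + real (Suc n))"
    by (rule arg_cong[where f=Gamma]) (simp add: algebra_simps)
  also have "\<dots> = real (Suc n) * fact n"
    unfolding Gamma_fact by simp
  finally show ?thesis
    by (simp add: stable_product_coeff_def Beta_def)
qed

lemma summable_stable_product_open_if_sum_eq_1:
  assumes \<alpha>: "0 < \<alpha>" "\<alpha> < 1" and z: "0 < z"
    and sum: "summable (\<lambda>n. stable_product_coeff \<alpha> (1 - \<alpha>) n * z ^ n)"
  shows "\<exists>z'>z. summable (\<lambda>n. stable_product_coeff \<alpha> (1 - \<alpha>) n * z' ^ n)"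
proof -
  define h where "h x = x powr \<alpha> * (1 - x) powr (1 - \<alpha>)" for x :: real
  have h_nonneg: "0 \<le> h x" for x by (simp add: h_def)
  define B where "B n = Beta (real n * \<alpha> + 1) (real n * (1 - \<alpha>) + 1)" for n
  have B: "((\<lambda>x. h x ^ n) has_integral B n) {0<..<1}" for n
  proof -
    have "((\<lambda>x. x powr ((real n * \<alpha> + 1) - 1) * (1 - x) powr ((real n * (1 - \<alpha>) + 1) - 1)) has_integral B n) {0..1}"
      unfolding B_def using \<alpha> by (intro has_integral_Beta_real add_nonneg_pos) auto
    hence "((\<lambda>x. x powr (real n * \<alpha>) * (1 - x) powr (real n * (1 - \<alpha>))) has_integral B n) {0<..<1}"
      by (simp add: has_integral_Icc_iff_Ioo)
    thus ?thesis
      by (rule has_integral_cong[THEN iffD1, rotated]) (auto simp: h_def power_mult_distrib powr_power)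
  qed
  have B_pos: "0 < B n" for n
    unfolding B_def Beta_def using \<alpha>
    by (intro divide_pos_pos mult_pos_pos Gamma_real_pos add_nonneg_pos add_pos_pos) auto
  have coeff: "stable_product_coeff \<alpha> (1 - \<alpha>) n = 1 / (real (Suc n) * B n)" for n
    using stable_product_coeff_eq_Beta[OF \<alpha>] by (simp add: B_def)
  \<comment> \<open>Otherwise \<open>B n \<le> z ^ n\<close>, and the series dominates the harmonic series.\<close>
  have "\<exists>x\<in>{0<..<1}. z < h x"
  proof (rule ccontr)
    assume "\<not> ?thesis"
    hence le: "h x \<le> z" if "x \<in> {0<..<1}" for x using that by force
    have "B n \<le> z ^ n" for n
    proof -
      have "((\<lambda>_. z ^ n) has_integral z ^ n) {0<..<1::real}"
        using has_integral_const_real[of "z ^ n" 0 1] by (simp add: has_integral_Icc_iff_Ioo)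
      thus ?thesis
        by (rule has_integral_le[OF B]) (use le in \<open>auto intro!: power_mono simp: h_def\<close>)
    qed
    hence "1 \<le> z ^ n / B n" for n
      using B_pos[of n] by simp
    hence "1 / real (Suc n) \<le> z ^ n / B n / real (Suc n)" for n
      by (intro divide_right_mono) auto
    hence "1 / real (Suc n) \<le> stable_product_coeff \<alpha> (1 - \<alpha>) n * z ^ n" for n
      by (simp only: coeff divide_divide_eq_left mult.commute times_divide_eq_right mult_1_right mult_1_left)
    hence "summable (\<lambda>n. 1 / real (Suc n))"
      by (intro summable_comparison_test'[OF sum, of 0]) auto
    hence "summable (\<lambda>n. inverse (real n))"
      by (subst summable_Suc_iff[symmetric]) (simp add: divide_inverse)
    thus False using not_summable_harmonic[where 'a=real] by simp
  qed
  then obtain x0 where x0: "0 < x0" "x0 < 1" "z < h x0" by auto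
  \<comment> \<open>Two points between \<open>z\<close> and \<open>h x0\<close>: near \<open>x0\<close> the function \<open>h\<close> exceeds the larger one, which bounds \<open>B n\<close> from below and gives geometric convergence at the smaller one.\<close>
  define z1 where "z1 = (2 * z + h x0) / 3"
  define z2 where "z2 = (z + 2 * h x0) / 3"
  have z12: "z < z1" "z1 < z2" "z2 < h x0" "0 < z1" using x0 z by (auto simp: z1_def z2_def)
  have "isCont h x0"
    unfolding h_def using x0 \<alpha> by (intro continuous_intros) auto
  hence "\<forall>\<^sub>F x in nhds x0. z2 < h x"
    using z12 by (intro order_tendstoD) (auto simp: isCont_def tendsto_at_iff_tendsto_nhds)
  moreover have "\<forall>\<^sub>F x in nhds x0. x \<in> {0<..<1}"
    using x0 by (intro eventually_nhds_in_open) auto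
  ultimately have "\<forall>\<^sub>F x in nhds x0. z2 < h x \<and> x \<in> {0<..<1}" by eventually_elim auto
  then obtain d where d: "0 < d" "\<And>x. dist x x0 < d \<Longrightarrow> z2 < h x \<and> x \<in> {0<..<1}"
    unfolding eventually_nhds_metric by blast
  have low: "d * z2 ^ n \<le> B n" for n
  proof -
    let ?I = "{x0 - d / 2..x0 + d / 2}"
    have "((\<lambda>_. z2 ^ n) has_integral d * z2 ^ n) ?I"
      using has_integral_const_real[of "z2 ^ n" "x0 - d / 2" "x0 + d / 2"] d(1) by simp
    moreover have "?I \<subseteq> {0<..<1}" using d by (auto simp: dist_real_def abs_if)
    ultimately have c: "((\<lambda>x. if x \<in> ?I then z2 ^ n else 0) has_integral d * z2 ^ n) {0<..<1}"
      by (subst has_integral_restrict)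
    show ?thesis
      by (rule has_integral_le[OF c B])
         (use d z12 z in \<open>auto intro!: power_mono less_imp_le[of z2] simp: h_nonneg dist_real_def abs_if\<close>)
  qed
  have "summable (\<lambda>n. stable_product_coeff \<alpha> (1 - \<alpha>) n * z1 ^ n)"
  proof (rule summable_comparison_test'[where N=0])
    show "summable (\<lambda>n. 1 / d * (z1 / z2) ^ n)"
      using z12 by (intro summable_mult summable_geometric) auto
    fix n :: nat
    have "z1 ^ n / (real (Suc n) * B n) \<le> z1 ^ n / (1 * (d * z2 ^ n))"
      using low[of n] B_pos[of n] d z12 by (intro divide_left_mono mult_mono mult_pos_pos) auto
    thus "norm (stable_product_coeff \<alpha> (1 - \<alpha>) n * z1 ^ n) \<le> 1 / d * (z1 / z2) ^ n"
      using B_pos[of n] z12 by (simp add: coeff power_divide abs_mult)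
  qed
  with z12 show ?thesis by blast
qed

text \<open>
  For \<open>\<alpha> + \<beta> < 1\<close> the series diverges at every positive point, for \<open>\<alpha> + \<beta> > 1\<close> it converges
  everywhere, and for \<open>\<alpha> + \<beta> = 1\<close> it diverges at its radius of convergence.
\<close>

lemma summable_stable_product_open:
  assumes "0 < \<alpha>" "\<alpha> < 1" "0 < \<beta>" "0 < z"
    and sum: "summable (\<lambda>n. stable_product_coeff \<alpha> \<beta> n * z ^ n)"
  shows "\<exists>z'>z. summable (\<lambda>n. stable_product_coeff \<alpha> \<beta> n * z' ^ n)"
proof -
  consider "\<alpha> + \<beta> < 1" | "\<alpha> + \<beta> = 1" | "1 < \<alpha> + \<beta>" by linarith
  thus ?thesis
  proof cases
    case 1
    thus ?thesis using not_summable_stable_product_if_sum_lt_1 assms by blast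
  next
    case 2
    hence "\<beta> = 1 - \<alpha>" by simp
    thus ?thesis using summable_stable_product_open_if_sum_eq_1 assms by blast
  next
    case 3
    thus ?thesis
      using summable_stable_product_if_sum_gt_1[of \<alpha> \<beta> "z + 1"] assms by (intro exI[of _ "z + 1"]) auto
  qed
qed

text \<open>
  The derivative is one-sided at \<open>b\<close> itself, where \<open>exp (b * Z)\<close> may be the last integrable
  exponential; to the left of \<open>b\<close> the difference quotients are dominated by \<open>V * Z * exp (b * Z)\<close>.
\<close>

lemma has_derivative_integral_exp:
  fixes V Z :: "'a \<Rightarrow> real"
  assumes [measurable]: "V \<in> borel_measurable M" "Z \<in> borel_measurable M"
    and nonneg: "\<And>\<omega>. 0 \<le> V \<omega>" "\<And>\<omega>. 0 \<le> Z \<omega>"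
    and int: "integrable M (\<lambda>\<omega>. V \<omega> * exp (b * Z \<omega>))" "integrable M (\<lambda>\<omega>. V \<omega> * Z \<omega> * exp (b * Z \<omega>))"
    and z: "z \<le> b"
  shows "((\<lambda>z. LINT \<omega>|M. V \<omega> * exp (z * Z \<omega>)) has_real_derivative
           (LINT \<omega>|M. V \<omega> * Z \<omega> * exp (z * Z \<omega>))) (at z within {..b})"
proof -
  have int_le: "integrable M (\<lambda>\<omega>. V \<omega> * exp (w * Z \<omega>))" if "w \<le> b" for w
    by (rule Bochner_Integration.integrable_bound[OF int(1)])
       (use nonneg that in \<open>auto intro!: AE_I2 mult_left_mono mult_right_mono simp: abs_mult\<close>)
  have lip: "\<bar>exp p - exp q\<bar> \<le> \<bar>p - q\<bar> * exp r" if "p \<le> r" "q \<le> r" for p q r :: real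
  proof -
    have *: "\<bar>exp p - exp q\<bar> \<le> \<bar>p - q\<bar> * exp r" if "q \<le> p" "p \<le> r" for p q
    proof -
      have "exp p - exp q = exp p * (1 - exp (q - p))" by (simp add: exp_diff field_simps)
      moreover have "1 - exp (q - p) \<le> p - q"
        using exp_ge_add_one_self[of "q - p"] by linarith
      hence "exp p * (1 - exp (q - p)) \<le> exp r * (p - q)"
        using that by (intro mult_mono) auto
      ultimately show ?thesis using that by (simp add: mult.commute)
    qed
    show ?thesis using *[of q p] *[of p q] that by (cases "q \<le> p") (auto simp: abs_minus_commute)
  qed
  show ?thesis
    unfolding has_field_derivative_iff tendsto_at_iff_sequentially comp_def
  proof (intro allI impI)
    fix x :: "nat \<Rightarrow> real" assume x: "\<forall>i. x i \<in> {..b} - {z}" "x \<longlonglongrightarrow> z"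
    let ?q = "\<lambda>i \<omega>. V \<omega> * ((exp (x i * Z \<omega>) - exp (z * Z \<omega>)) / (x i - z))"
    have "(\<lambda>i. LINT \<omega>|M. ?q i \<omega>) \<longlonglongrightarrow> (LINT \<omega>|M. V \<omega> * Z \<omega> * exp (z * Z \<omega>))"
    proof (rule integral_dominated_convergence[OF _ _ int(2)])
      show "AE \<omega> in M. (\<lambda>i. ?q i \<omega>) \<longlonglongrightarrow> V \<omega> * Z \<omega> * exp (z * Z \<omega>)"
      proof (rule AE_I2)
        fix \<omega>
        have "((\<lambda>w. exp (w * Z \<omega>)) has_real_derivative Z \<omega> * exp (z * Z \<omega>)) (at z)"
          by (auto intro!: derivative_eq_intros)
        hence "(\<lambda>i. (exp (x i * Z \<omega>) - exp (z * Z \<omega>)) / (x i - z)) \<longlonglongrightarrow> Z \<omega> * exp (z * Z \<omega>)"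
          using x unfolding has_field_derivative_iff tendsto_at_iff_sequentially comp_def by auto
        from tendsto_mult_left[OF this, of "V \<omega>"]
        show "(\<lambda>i. ?q i \<omega>) \<longlonglongrightarrow> V \<omega> * Z \<omega> * exp (z * Z \<omega>)" by (simp add: mult.assoc)
      qed
      show "AE \<omega> in M. norm (?q i \<omega>) \<le> V \<omega> * Z \<omega> * exp (b * Z \<omega>)" for i
      proof (rule AE_I2)
        fix \<omega>
        have xi: "x i \<le> b" "x i \<noteq> z" using x by auto
        have "\<bar>exp (x i * Z \<omega>) - exp (z * Z \<omega>)\<bar> \<le> \<bar>x i * Z \<omega> - z * Z \<omega>\<bar> * exp (b * Z \<omega>)"
          using xi z nonneg by (intro lip mult_right_mono) auto
        also have "\<bar>x i * Z \<omega> - z * Z \<omega>\<bar> = \<bar>x i - z\<bar> * Z \<omega>"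
          using nonneg by (simp add: abs_mult flip: left_diff_distrib)
        finally have "\<bar>exp (x i * Z \<omega>) - exp (z * Z \<omega>)\<bar> / \<bar>x i - z\<bar> \<le> Z \<omega> * exp (b * Z \<omega>)"
          using xi by (simp add: field_simps)
        from mult_left_mono[OF this nonneg(1)[of \<omega>]]
        show "norm (?q i \<omega>) \<le> V \<omega> * Z \<omega> * exp (b * Z \<omega>)"
          using nonneg by (simp add: abs_mult mult.assoc)
      qed
    qed measurable
    also have "(\<lambda>i. LINT \<omega>|M. ?q i \<omega>) =
        (\<lambda>i. ((LINT \<omega>|M. V \<omega> * exp (x i * Z \<omega>)) - (LINT \<omega>|M. V \<omega> * exp (z * Z \<omega>))) / (x i - z))"
    proof
      fix i
      have "x i \<le> b" using x by auto
      hence "(LINT \<omega>|M. V \<omega> * exp (x i * Z \<omega>)) - (LINT \<omega>|M. V \<omega> * exp (z * Z \<omega>)) =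
          (LINT \<omega>|M. V \<omega> * exp (x i * Z \<omega>) - V \<omega> * exp (z * Z \<omega>))"
        using z by (intro Bochner_Integration.integral_diff[symmetric] int_le) auto
      thus "(LINT \<omega>|M. ?q i \<omega>) =
          ((LINT \<omega>|M. V \<omega> * exp (x i * Z \<omega>)) - (LINT \<omega>|M. V \<omega> * exp (z * Z \<omega>))) / (x i - z)"
        by (simp add: right_diff_distrib)
    qed
    finally show "(\<lambda>i. ((LINT \<omega>|M. V \<omega> * exp (x i * Z \<omega>)) - (LINT \<omega>|M. V \<omega> * exp (z * Z \<omega>))) / (x i - z))
        \<longlonglongrightarrow> (LINT \<omega>|M. V \<omega> * Z \<omega> * exp (z * Z \<omega>))" .
  qed
qed

text \<open>
  For \<open>k \<ge> 0\<close> the bound is the value at \<open>T\<close>, for \<open>k < 0\<close> it is \<open>0\<close>. Taking the maximum lets both signs of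
  the exponent be treated together from here on.
\<close>

lemma power_time_le:
  fixes k \<gamma> r T :: real
  assumes "0 \<le> r" "r \<le> T" "0 < \<gamma>"
  shows "k * r powr \<gamma> \<le> max 0 (k * T powr \<gamma>)"
proof (cases "0 \<le> k")
  case True
  hence "k * r powr \<gamma> \<le> k * T powr \<gamma>"
    using assms by (intro mult_left_mono powr_mono2) auto
  thus ?thesis by simp
next
  case False
  hence "k * r powr \<gamma> \<le> 0" by (simp add: mult_nonpos_nonneg)
  thus ?thesis by simp
qed

lemma has_derivative_power_time:
  fixes k \<gamma> r T :: real
  assumes deriv: "(\<Phi> has_real_derivative D) (at (k * r powr \<gamma>) within {..max 0 (k * T powr \<gamma>)})"
    and r: "0 < r" "r < T" and \<gamma>: "0 < \<gamma>"
  shows "((\<lambda>\<sigma>. \<Phi> (k * \<sigma> powr \<gamma>)) has_real_derivative D * (k * (\<gamma> * r powr (\<gamma> - 1)))) (at r)"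
proof -
  let ?g = "\<lambda>\<sigma>. k * \<sigma> powr \<gamma>"
  have "?g ` {0<..<T} \<subseteq> {..max 0 (k * T powr \<gamma>)}"
    using power_time_le[of _ T \<gamma> k] \<gamma> by auto
  hence "(\<Phi> has_real_derivative D) (at (?g r) within ?g ` {0<..<T})"
    using deriv by (rule DERIV_subset[rotated])
  moreover have "(?g has_real_derivative k * (\<gamma> * r powr (\<gamma> - 1))) (at r within {0<..<T})"
    using r by (auto intro!: derivative_eq_intros)
  ultimately have "(\<Phi> \<circ> ?g has_real_derivative D * (k * (\<gamma> * r powr (\<gamma> - 1)))) (at r within {0<..<T})"
    by (rule DERIV_image_chain)
  thus ?thesis using r by (simp add: at_within_open[of _ "{0<..<T}"] comp_def)
qed

lemma integrable_pair_mult: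
  fixes f :: "'a \<Rightarrow> real" and g :: "'b \<Rightarrow> real"
  assumes "prob_space A" "prob_space B" and f: "integrable A f" and g: "integrable B g"
  shows "integrable (A \<Otimes>\<^sub>M B) (\<lambda>p. f (fst p) * g (snd p))"
proof -
  interpret A: prob_space A by fact
  interpret B: prob_space B by fact
  interpret pair_prob_space A B ..
  have [measurable]: "f \<in> borel_measurable A" "g \<in> borel_measurable B" using f g by auto
  have "integrable (A \<Otimes>\<^sub>M B) (\<lambda>(x, y). f x * g y)"
  proof (rule Fubini_integrable)
    show "integrable A (\<lambda>x. LINT y|B. norm (case (x, y) of (x, y) \<Rightarrow> f x * g y))"
      using f by (simp add: abs_mult)
    show "AE x in A. integrable B (\<lambda>y. case (x, y) of (x, y) \<Rightarrow> f x * g y)"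
      using g by simp
  qed measurable
  thus ?thesis by (simp add: case_prod_beta')
qed

locale stable_product = A: mittag_leffler A \<alpha> X + B: mittag_leffler B \<beta> Y
  for A :: "'a measure" and \<alpha> X and B :: "'b measure" and \<beta> Y
begin

sublocale AB: mittag_leffler_times A \<alpha> X B ..
sublocale BA: mittag_leffler_times B \<beta> Y A ..

definition Z :: "'a \<times> 'b \<Rightarrow> real" where "Z p = X (fst p) * Y (snd p)"

text \<open>
  Always contains the nonpositive half-line. It is \<open>{..0}\<close> for \<open>\<alpha> + \<beta> < 1\<close>, an open half-line for
  \<open>\<alpha> + \<beta> = 1\<close>, and the whole line for \<open>\<alpha> + \<beta> > 1\<close>.
\<close>

definition exp_domain :: "real set" where
  "exp_domain = {z. integrable (A \<Otimes>\<^sub>M B) (\<lambda>p. exp (z * Z p))}"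

lemma measurable_Z [measurable]: "Z \<in> borel_measurable (A \<Otimes>\<^sub>M B)"
  unfolding Z_def by measurable

lemma Z_nonneg: "0 \<le> Z p"
  by (simp add: Z_def A.nonneg B.nonneg)

lemma exp_domain_iff_summable:
  assumes "0 \<le> z"
  shows "z \<in> exp_domain \<longleftrightarrow> summable (\<lambda>n. stable_product_coeff \<alpha> \<beta> n * z ^ n)"
proof -
  have mom: "(\<integral>\<^sup>+p. ennreal (Z p ^ n) \<partial>(A \<Otimes>\<^sub>M B)) =
      ennreal (fact n / Gamma (real n * \<alpha> + 1)) * ennreal (fact n / Gamma (real n * \<beta> + 1))" for n
  proof -
    have "(\<integral>\<^sup>+p. ennreal (Z p ^ n) \<partial>(A \<Otimes>\<^sub>M B)) = (\<integral>\<^sup>+a. \<integral>\<^sup>+b. ennreal (Z (a, b) ^ n) \<partial>B \<partial>A)"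
      by (rule B.nn_integral_fst[symmetric]) measurable
    also have "\<dots> = (\<integral>\<^sup>+a. \<integral>\<^sup>+b. ennreal (X a ^ n) * ennreal (Y b ^ n) \<partial>B \<partial>A)"
      using A.nonneg by (simp add: Z_def power_mult_distrib ennreal_mult')
    also have "\<dots> = (\<integral>\<^sup>+a. ennreal (X a ^ n) \<partial>A) * (\<integral>\<^sup>+b. ennreal (Y b ^ n) \<partial>B)"
      by (simp add: nn_integral_cmult nn_integral_multc)
    finally show ?thesis by (simp add: A.moments B.moments)
  qed
  have pos: "0 \<le> stable_product_coeff \<alpha> \<beta> n * z ^ n" for n
    using stable_product_coeff_pos[OF A.index(1) B.index(1), of n] assms by simp
  have term_eq: "ennreal (z ^ n / fact n) * (\<integral>\<^sup>+p. ennreal (Z p ^ n) \<partial>(A \<Otimes>\<^sub>M B)) =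
      ennreal (stable_product_coeff \<alpha> \<beta> n * z ^ n)" for n
  proof -
    have "ennreal (z ^ n / fact n) * (\<integral>\<^sup>+p. ennreal (Z p ^ n) \<partial>(A \<Otimes>\<^sub>M B)) =
        ennreal (z ^ n / fact n * (fact n / Gamma (real n * \<alpha> + 1) * (fact n / Gamma (real n * \<beta> + 1))))"
      unfolding mom using assms A.Gamma_pos[of n] B.Gamma_pos[of n]
      by (simp only: ennreal_mult' divide_nonneg_pos zero_le_power fact_gt_zero fact_ge_zero mult_nonneg_nonneg)
    also have "z ^ n / fact n * (fact n / Gamma (real n * \<alpha> + 1) * (fact n / Gamma (real n * \<beta> + 1))) =
        stable_product_coeff \<alpha> \<beta> n * z ^ n"
      by (simp add: stable_product_coeff_def)
    finally show ?thesis .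
  qed
  have series: "(\<integral>\<^sup>+p. ennreal (exp (z * Z p)) \<partial>(A \<Otimes>\<^sub>M B)) = (\<Sum>n. ennreal (stable_product_coeff \<alpha> \<beta> n * z ^ n))"
    by (subst nn_integral_exp_eq_series) (simp_all add: Z_nonneg assms term_eq)
  show ?thesis
  proof
    assume "z \<in> exp_domain"
    hence "(\<integral>\<^sup>+p. ennreal (exp (z * Z p)) \<partial>(A \<Otimes>\<^sub>M B)) < \<infinity>"
      by (simp add: exp_domain_def integrable_iff_bounded)
    thus "summable (\<lambda>n. stable_product_coeff \<alpha> \<beta> n * z ^ n)"
      unfolding series by (intro summable_suminf_not_top pos) auto
  next
    assume "summable (\<lambda>n. stable_product_coeff \<alpha> \<beta> n * z ^ n)"
    hence "(\<integral>\<^sup>+p. ennreal (exp (z * Z p)) \<partial>(A \<Otimes>\<^sub>M B)) < \<infinity>"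
      unfolding series by (subst suminf_ennreal2[OF pos]) auto
    thus "z \<in> exp_domain"
      unfolding exp_domain_def by (auto intro!: integrableI_nonneg)
  qed
qed

lemma exp_domain_open_pos:
  assumes "z \<in> exp_domain" "0 < z" shows "\<exists>z'>z. z' \<in> exp_domain"
proof -
  have "summable (\<lambda>n. stable_product_coeff \<alpha> \<beta> n * z ^ n)"
    using assms exp_domain_iff_summable by simp
  then obtain z' where "z < z'" "summable (\<lambda>n. stable_product_coeff \<alpha> \<beta> n * z' ^ n)"
    using summable_stable_product_open A.index B.index assms(2) by blast
  thus ?thesis using assms exp_domain_iff_summable[of z'] by auto
qed

lemma exp_domain_nonpos: "z \<le> 0 \<Longrightarrow> z \<in> exp_domain"
  unfolding exp_domain_def using Z_nonneg
  by (auto intro!: AB.P.integrable_const_bound[where B=1] simp: mult_nonpos_nonneg)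

lemma exp_domain_down: "z \<in> exp_domain \<Longrightarrow> w \<le> z \<Longrightarrow> w \<in> exp_domain"
  unfolding exp_domain_def
  by (auto intro!: mult_right_mono Z_nonneg elim!: Bochner_Integration.integrable_bound)

text \<open>
  A power of \<open>Z\<close> is absorbed by a slightly larger exponent when \<open>z > 0\<close>, and by the moments of \<open>X\<close> and
  \<open>Y\<close> when \<open>z \<le> 0\<close>.
\<close>

lemma integrable_Z_exp:
  assumes z: "z \<in> exp_domain"
  shows "integrable (A \<Otimes>\<^sub>M B) (\<lambda>p. Z p ^ j * exp (z * Z p))"
proof (cases "0 < z")
  case True
  then obtain z' where z': "z < z'" "z' \<in> exp_domain" using exp_domain_open_pos z by blast
  hence "integrable (A \<Otimes>\<^sub>M B) (\<lambda>p. fact j / (z' - z) ^ j * exp (z' * Z p))"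
    by (intro integrable_mult_right) (simp add: exp_domain_def)
  thus ?thesis
  proof (rule Bochner_Integration.integrable_bound, measurable, intro AE_I2)
    fix p
    have "((z' - z) * Z p) ^ j \<le> fact j * exp ((z' - z) * Z p)"
      using z' Z_nonneg by (intro power_le_fact_mult_exp) auto
    hence "Z p ^ j \<le> fact j / (z' - z) ^ j * exp ((z' - z) * Z p)"
      using z' by (simp add: power_mult_distrib pos_le_divide_eq mult.commute)
    hence "Z p ^ j * exp (z * Z p) \<le> fact j / (z' - z) ^ j * exp ((z' - z) * Z p) * exp (z * Z p)"
      by (rule mult_right_mono) simp
    also have "\<dots> = fact j / (z' - z) ^ j * exp (z' * Z p)"
      by (simp add: algebra_simps flip: exp_add)
    finally show "norm (Z p ^ j * exp (z * Z p)) \<le> norm (fact j / (z' - z) ^ j * exp (z' * Z p))"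
      using z' Z_nonneg by (simp add: abs_mult)
  qed
next
  case False
  have "integrable (A \<Otimes>\<^sub>M B) (\<lambda>p. X (fst p) ^ j * Y (snd p) ^ j)"
    by (rule integrable_pair_mult[OF A.prob_space_axioms B.prob_space_axioms A.integrable_power B.integrable_power])
  thus ?thesis
  proof (rule Bochner_Integration.integrable_bound, measurable, intro AE_I2)
    fix p
    have "Z p ^ j * exp (z * Z p) \<le> Z p ^ j * 1"
      using False Z_nonneg by (intro mult_left_mono) (auto simp: mult_nonpos_nonneg)
    thus "norm (Z p ^ j * exp (z * Z p)) \<le> norm (X (fst p) ^ j * Y (snd p) ^ j)"
      using Z_nonneg[of p] A.nonneg B.nonneg by (simp add: abs_mult power_mult_distrib Z_def)
  qed
qed

text \<open>
  Where \<open>X \<ge> 1\<close> the factor \<open>Y\<close> is at most \<open>Z\<close>; where \<open>X \<le> 1\<close> the variable \<open>Z\<close> is at most \<open>Y\<close>, all of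
  whose exponential moments are finite.
\<close>

lemma integrable_Y_Z_exp:
  assumes z: "z \<in> exp_domain"
  shows "integrable (A \<Otimes>\<^sub>M B) (\<lambda>p. Y (snd p) * Z p ^ j * exp (z * Z p))"
proof (rule Bochner_Integration.integrable_bound)
  have "integrable (A \<Otimes>\<^sub>M B) (\<lambda>p. 1 * (Y (snd p) ^ Suc j * exp (\<bar>z\<bar> * Y (snd p))))"
    by (rule integrable_pair_mult[OF A.prob_space_axioms B.prob_space_axioms _ B.integrable_power_exp]) simp
  thus "integrable (A \<Otimes>\<^sub>M B) (\<lambda>p. Y (snd p) ^ Suc j * exp (\<bar>z\<bar> * Y (snd p)) + Z p ^ Suc j * exp (z * Z p))"
    by (intro Bochner_Integration.integrable_add integrable_Z_exp[OF z]) simp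
  show "AE p in A \<Otimes>\<^sub>M B. norm (Y (snd p) * Z p ^ j * exp (z * Z p)) \<le>
      norm (Y (snd p) ^ Suc j * exp (\<bar>z\<bar> * Y (snd p)) + Z p ^ Suc j * exp (z * Z p))"
  proof (rule AE_I2)
    fix p :: "'a \<times> 'b"
    let ?y = "Y (snd p)"
    have y: "0 \<le> ?y" by (rule B.nonneg)
    have nn: "0 \<le> ?y ^ Suc j * exp (\<bar>z\<bar> * ?y)" "0 \<le> Z p ^ Suc j * exp (z * Z p)"
      using y Z_nonneg by simp_all
    have "?y * Z p ^ j * exp (z * Z p) \<le> ?y ^ Suc j * exp (\<bar>z\<bar> * ?y) + Z p ^ Suc j * exp (z * Z p)"
    proof (cases "X (fst p) \<le> 1")
      case True
      hence Zy: "Z p \<le> ?y" using y by (simp add: Z_def mult_left_le_one_le A.nonneg)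
      have "z * Z p \<le> \<bar>z\<bar> * ?y"
        using Zy Z_nonneg[of p] by (intro mult_mono) auto
      hence "?y * Z p ^ j * exp (z * Z p) \<le> ?y * ?y ^ j * exp (\<bar>z\<bar> * ?y)"
        using Zy y Z_nonneg[of p] by (intro mult_mono power_mono) auto
      thus ?thesis using nn by simp
    next
      case False
      hence "1 * ?y \<le> Z p" unfolding Z_def using y by (intro mult_right_mono) auto
      hence "?y * Z p ^ j * exp (z * Z p) \<le> Z p * Z p ^ j * exp (z * Z p)"
        using Z_nonneg[of p] by (intro mult_right_mono) auto
      thus ?thesis using nn by simp
    qed
    thus "norm (?y * Z p ^ j * exp (z * Z p)) \<le> norm (?y ^ Suc j * exp (\<bar>z\<bar> * ?y) + Z p ^ Suc j * exp (z * Z p))"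
      using nn y Z_nonneg[of p] by (simp add: abs_mult)
  qed
qed measurable

lemma max_0_in_exp_domain: "z \<in> exp_domain \<Longrightarrow> max 0 z \<in> exp_domain"
  using exp_domain_nonpos[of 0] by (auto simp: max_def)

lemma has_derivative_exp_transform:
  assumes b: "b \<in> exp_domain" and z: "z \<le> b"
  shows "((\<lambda>z. LINT p|(A \<Otimes>\<^sub>M B). exp (z * Z p)) has_real_derivative
      (LINT p|(A \<Otimes>\<^sub>M B). Z p * exp (z * Z p))) (at z within {..b})"
    and "((\<lambda>z. LINT p|(A \<Otimes>\<^sub>M B). Y (snd p) * exp (z * Z p)) has_real_derivative
      (LINT p|(A \<Otimes>\<^sub>M B). Y (snd p) * Z p * exp (z * Z p))) (at z within {..b})"
proof -
  have "((\<lambda>z. LINT p|(A \<Otimes>\<^sub>M B). 1 * exp (z * Z p)) has_real_derivative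
      (LINT p|(A \<Otimes>\<^sub>M B). 1 * Z p * exp (z * Z p))) (at z within {..b})"
    by (rule has_derivative_integral_exp[OF _ _ _ _ _ _ z])
       (use integrable_Z_exp[OF b, of 0] integrable_Z_exp[OF b, of 1] Z_nonneg in auto)
  thus "((\<lambda>z. LINT p|(A \<Otimes>\<^sub>M B). exp (z * Z p)) has_real_derivative
      (LINT p|(A \<Otimes>\<^sub>M B). Z p * exp (z * Z p))) (at z within {..b})" by simp
  show "((\<lambda>z. LINT p|(A \<Otimes>\<^sub>M B). Y (snd p) * exp (z * Z p)) has_real_derivative
      (LINT p|(A \<Otimes>\<^sub>M B). Y (snd p) * Z p * exp (z * Z p))) (at z within {..b})"
    by (rule has_derivative_integral_exp[OF _ _ _ _ _ _ z])
       (use integrable_Y_Z_exp[OF b, of 0] integrable_Y_Z_exp[OF b, of 1] Z_nonneg B.nonneg in auto)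
qed

text \<open>
  At \<open>0\<close> the domain may end, in which case only the derivative from the left is claimed.
\<close>

lemma has_derivative_on_exp_domain:
  assumes z: "z \<in> exp_domain"
  shows "((\<lambda>z. LINT p|(A \<Otimes>\<^sub>M B). exp (z * Z p)) has_real_derivative
      (LINT p|(A \<Otimes>\<^sub>M B). Z p * exp (z * Z p))) (at z within exp_domain)"
proof (cases "\<exists>b. max 0 z < b \<and> b \<in> exp_domain")
  case True
  then obtain b where b: "z < b" "b \<in> exp_domain" by auto
  have "((\<lambda>z. LINT p|(A \<Otimes>\<^sub>M B). exp (z * Z p)) has_real_derivative
      (LINT p|(A \<Otimes>\<^sub>M B). Z p * exp (z * Z p))) (at z within {..<b})"
    using has_derivative_exp_transform(1)[OF b(2) less_imp_le[OF b(1)]] by (rule DERIV_subset) auto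
  hence "((\<lambda>z. LINT p|(A \<Otimes>\<^sub>M B). exp (z * Z p)) has_real_derivative
      (LINT p|(A \<Otimes>\<^sub>M B). Z p * exp (z * Z p))) (at z)"
    using b(1) by (simp add: at_within_open[of _ "{..<b}"])
  thus ?thesis by (rule has_field_derivative_at_within)
next
  case False
  have "z \<le> 0"
  proof (rule ccontr)
    assume "\<not> z \<le> 0"
    hence "0 < z" by simp
    then obtain b where "z < b" "b \<in> exp_domain" using exp_domain_open_pos[OF z] by blast
    with False \<open>0 < z\<close> show False by auto
  qed
  moreover have "exp_domain \<subseteq> {..0}"
  proof (rule subsetI, rule ccontr)
    fix w assume "w \<in> exp_domain" "w \<notin> {..0}"
    with False \<open>z \<le> 0\<close> show False by (auto simp: max_def)
  qed
  ultimately show ?thesis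
    using has_derivative_exp_transform(1)[OF exp_domain_nonpos[of 0], of z] by (auto intro: DERIV_subset)
qed

text \<open>
  The Caputo rule in \<open>\<sigma>\<close> for \<open>h v = k * Y * exp (k * Y * v)\<close> with \<open>k = c * \<tau> powr \<beta>\<close>, the
  derivative of \<open>exp (k * Y * v)\<close>.
\<close>

lemma caputo_first:
  fixes c s \<tau> :: real
  assumes s: "0 < s" and dom: "c * s powr \<alpha> * \<tau> powr \<beta> \<in> exp_domain"
    and f: "\<And>\<sigma>. 0 < \<sigma> \<Longrightarrow> \<sigma> < s \<Longrightarrow>
      f \<sigma> = (LINT p|(A \<Otimes>\<^sub>M B). exp (c * \<sigma> powr \<alpha> * \<tau> powr \<beta> * Z p))"
  shows "caputo_differentiable \<alpha> f s"
    and "caputo_deriv \<alpha> f s = c * \<tau> powr \<beta> *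
      (LINT p|(A \<Otimes>\<^sub>M B). Y (snd p) * exp (c * s powr \<alpha> * \<tau> powr \<beta> * Z p))"
proof -
  let ?k = "c * \<tau> powr \<beta>"
  let ?h = "\<lambda>q. ?k * (Y (snd q) * exp (?k * Y (snd q) * fst q))"
  have expo: "?k * Y (snd p) * (r powr \<alpha> * X (fst p)) = c * r powr \<alpha> * \<tau> powr \<beta> * Z p" for p r
    by (simp add: Z_def mult_ac)
  have int: "integrable (A \<Otimes>\<^sub>M B) (\<lambda>p. ?h (s powr \<alpha> * X (fst p), snd p))"
    using integrable_Y_Z_exp[OF dom, of 0] by (simp add: expo)
  have deriv: "(f has_real_derivative \<alpha> * r powr (\<alpha> - 1) *
      (LINT p|(A \<Otimes>\<^sub>M B). X (fst p) * ?h (r powr \<alpha> * X (fst p), snd p))) (at r)"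
    if r: "0 < r" "r < s" for r
  proof -
    let ?\<Phi> = "\<lambda>z. LINT p|(A \<Otimes>\<^sub>M B). exp (z * Z p)"
    have b: "max 0 (?k * s powr \<alpha>) \<in> exp_domain"
      using max_0_in_exp_domain[OF dom] by (simp add: mult_ac)
    have "?k * r powr \<alpha> \<le> max 0 (?k * s powr \<alpha>)"
      using r A.index by (intro power_time_le) auto
    from has_derivative_power_time[OF has_derivative_exp_transform(1)[OF b this] r A.index(1)]
    have "((\<lambda>\<sigma>. ?\<Phi> (?k * \<sigma> powr \<alpha>)) has_real_derivative
        (LINT p|(A \<Otimes>\<^sub>M B). Z p * exp (?k * r powr \<alpha> * Z p)) * (?k * (\<alpha> * r powr (\<alpha> - 1)))) (at r)" .
    hence "(f has_real_derivative
        (LINT p|(A \<Otimes>\<^sub>M B). Z p * exp (?k * r powr \<alpha> * Z p)) * (?k * (\<alpha> * r powr (\<alpha> - 1)))) (at r)"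
      by (rule has_field_derivative_transform_within_open[of _ _ _ "{0<..<s}"])
         (use r f in \<open>auto simp: mult_ac\<close>)
    moreover have "(LINT p|(A \<Otimes>\<^sub>M B). X (fst p) * ?h (r powr \<alpha> * X (fst p), snd p)) =
        (LINT p|(A \<Otimes>\<^sub>M B). ?k * (Z p * exp (?k * r powr \<alpha> * Z p)))"
      by (rule Bochner_Integration.integral_cong) (simp_all add: Z_def mult_ac)
    hence "(LINT p|(A \<Otimes>\<^sub>M B). X (fst p) * ?h (r powr \<alpha> * X (fst p), snd p)) =
        ?k * (LINT p|(A \<Otimes>\<^sub>M B). Z p * exp (?k * r powr \<alpha> * Z p))"
      by (simp only: integral_mult_right_zero)
    ultimately show ?thesis
      by (simp only:) (erule DERIV_cong, simp only: mult_ac)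
  qed
  have "?h \<in> borel_measurable (borel \<Otimes>\<^sub>M B)" by measurable
  note caputo = AB.caputo_if_kernel_derivative[OF s this int deriv]
  show "caputo_differentiable \<alpha> f s" by (rule caputo(1))
  show "caputo_deriv \<alpha> f s = ?k *
      (LINT p|(A \<Otimes>\<^sub>M B). Y (snd p) * exp (c * s powr \<alpha> * \<tau> powr \<beta> * Z p))"
    using caputo(2) by (simp add: expo)
qed

text \<open>
  The Caputo rule in \<open>\<tau>\<close>, with the roles of \<open>X\<close> and \<open>Y\<close> exchanged: \<open>h\<close> is the derivative in \<open>v\<close> of
  \<open>c * v * exp (k * X * v)\<close> with \<open>k = c * s powr \<alpha>\<close>, and \<open>v\<close> stands for \<open>\<tau> powr \<beta> * Y\<close>.
\<close>

lemma caputo_second: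
  fixes c s t :: real
  assumes t: "0 < t" and dom: "c * s powr \<alpha> * t powr \<beta> \<in> exp_domain"
    and g: "\<And>\<tau>. 0 < \<tau> \<Longrightarrow> \<tau> < t \<Longrightarrow>
      g \<tau> = c * \<tau> powr \<beta> * (LINT p|(A \<Otimes>\<^sub>M B). Y (snd p) * exp (c * s powr \<alpha> * \<tau> powr \<beta> * Z p))"
  defines "z \<equiv> c * s powr \<alpha> * t powr \<beta>"
  shows "caputo_differentiable \<beta> g t"
    and "caputo_deriv \<beta> g t = c * (LINT p|(A \<Otimes>\<^sub>M B). exp (z * Z p)) +
      c * z * (LINT p|(A \<Otimes>\<^sub>M B). Z p * exp (z * Z p))"
proof -
  let ?k = "c * s powr \<alpha>"
  let ?h = "\<lambda>q. c * (1 + ?k * X (snd q) * fst q) * exp (?k * X (snd q) * fst q)"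
  let ?Z' = "\<lambda>q. Z (snd q, fst q)"
  have swap: "(LINT q|(B \<Otimes>\<^sub>M A). F (snd q, fst q)) = (LINT p|(A \<Otimes>\<^sub>M B). F p)"
    if "F \<in> borel_measurable (A \<Otimes>\<^sub>M B)" for F :: "'a \<times> 'b \<Rightarrow> real"
    using AB.P.integral_product_swap[OF that] by (simp add: case_prod_beta')
  have expo: "?k * X (snd q) * (r powr \<beta> * Y (fst q)) = ?k * r powr \<beta> * ?Z' q" for q r
    by (simp add: Z_def mult_ac)
  have z: "z \<in> exp_domain" using dom by (simp add: z_def)
  have int_h: "integrable (A \<Otimes>\<^sub>M B) (\<lambda>p. c * (1 + z * Z p) * exp (z * Z p))"
  proof -
    have "integrable (A \<Otimes>\<^sub>M B) (\<lambda>p. c * (Z p ^ 0 * exp (z * Z p)) + c * z * (Z p ^ 1 * exp (z * Z p)))"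
      by (intro Bochner_Integration.integrable_add integrable_mult_right integrable_Z_exp z)
    thus ?thesis by (simp add: algebra_simps)
  qed
  have int: "integrable (B \<Otimes>\<^sub>M A) (\<lambda>p. ?h (t powr \<beta> * Y (fst p), snd p))"
    using AB.P.integrable_product_swap[OF int_h] by (simp add: expo z_def case_prod_beta')
  have deriv: "(g has_real_derivative \<beta> * r powr (\<beta> - 1) *
      (LINT q|(B \<Otimes>\<^sub>M A). Y (fst q) * ?h (r powr \<beta> * Y (fst q), snd q))) (at r)"
    if r: "0 < r" "r < t" for r
  proof -
    let ?\<Theta> = "\<lambda>z. LINT p|(A \<Otimes>\<^sub>M B). Y (snd p) * exp (z * Z p)"
    let ?\<Theta>' = "\<lambda>z. LINT p|(A \<Otimes>\<^sub>M B). Y (snd p) * Z p * exp (z * Z p)"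
    let ?zr = "?k * r powr \<beta>"
    have b: "max 0 (?k * t powr \<beta>) \<in> exp_domain"
      using max_0_in_exp_domain[OF dom] by simp
    have zr: "?zr \<le> max 0 (?k * t powr \<beta>)"
      using r B.index by (intro power_time_le) auto
    have zr_dom: "?zr \<in> exp_domain" by (rule exp_domain_down[OF b zr])
    have "((\<lambda>\<tau>. ?\<Theta> (?k * \<tau> powr \<beta>)) has_real_derivative ?\<Theta>' ?zr * (?k * (\<beta> * r powr (\<beta> - 1)))) (at r)"
      by (rule has_derivative_power_time[OF has_derivative_exp_transform(2)[OF b zr] r B.index(1)])
    hence "((\<lambda>\<tau>. c * \<tau> powr \<beta> * ?\<Theta> (?k * \<tau> powr \<beta>)) has_real_derivative
        c * (\<beta> * r powr (\<beta> - 1)) * ?\<Theta> ?zr + ?\<Theta>' ?zr * (?k * (\<beta> * r powr (\<beta> - 1))) * (c * r powr \<beta>)) (at r)"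
      using r by (auto intro!: derivative_eq_intros)
    hence "(g has_real_derivative
        c * (\<beta> * r powr (\<beta> - 1)) * ?\<Theta> ?zr + ?\<Theta>' ?zr * (?k * (\<beta> * r powr (\<beta> - 1))) * (c * r powr \<beta>)) (at r)"
      by (rule has_field_derivative_transform_within_open[of _ _ _ "{0<..<t}"]) (use r g in auto)
    moreover have "(LINT q|(B \<Otimes>\<^sub>M A). Y (fst q) * ?h (r powr \<beta> * Y (fst q), snd q)) =
        c * ?\<Theta> ?zr + c * ?zr * ?\<Theta>' ?zr"
    proof -
      let ?F = "\<lambda>p. c * (Y (snd p) * exp (?zr * Z p)) + c * ?zr * (Y (snd p) * Z p * exp (?zr * Z p))"
      have "integrable (A \<Otimes>\<^sub>M B) (\<lambda>p. Y (snd p) * exp (?zr * Z p))"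
        and "integrable (A \<Otimes>\<^sub>M B) (\<lambda>p. Y (snd p) * Z p * exp (?zr * Z p))"
        using integrable_Y_Z_exp[OF zr_dom, of 0] integrable_Y_Z_exp[OF zr_dom, of 1] by simp_all
      note int_F = this[THEN integrable_mult_right]
      have "(LINT q|(B \<Otimes>\<^sub>M A). Y (fst q) * ?h (r powr \<beta> * Y (fst q), snd q)) = (LINT q|(B \<Otimes>\<^sub>M A). ?F (snd q, fst q))"
        by (rule Bochner_Integration.integral_cong) (simp_all add: Z_def algebra_simps)
      also have "\<dots> = (LINT p|(A \<Otimes>\<^sub>M B). ?F p)" by (rule swap) measurable
      also have "\<dots> = c * ?\<Theta> ?zr + c * ?zr * ?\<Theta>' ?zr"
        by (subst Bochner_Integration.integral_add[OF int_F]) simp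
      finally show ?thesis .
    qed
    ultimately show ?thesis by (simp add: algebra_simps)
  qed
  have "?h \<in> borel_measurable (borel \<Otimes>\<^sub>M A)" by measurable
  note caputo = BA.caputo_if_kernel_derivative[OF t this int deriv]
  show "caputo_differentiable \<beta> g t" by (rule caputo(1))
  have "caputo_deriv \<beta> g t = (LINT q|(B \<Otimes>\<^sub>M A). (\<lambda>p. c * (1 + z * Z p) * exp (z * Z p)) (snd q, fst q))"
    using caputo(2) by (simp only: expo z_def fst_conv snd_conv)
  also have "\<dots> = (LINT p|(A \<Otimes>\<^sub>M B). c * (1 + z * Z p) * exp (z * Z p))"
    by (rule swap) measurable
  also have "\<dots> = (LINT p|(A \<Otimes>\<^sub>M B). c * exp (z * Z p) + c * z * (Z p * exp (z * Z p)))"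
    by (simp add: algebra_simps)
  also have "\<dots> = c * (LINT p|(A \<Otimes>\<^sub>M B). exp (z * Z p)) + c * z * (LINT p|(A \<Otimes>\<^sub>M B). Z p * exp (z * Z p))"
    using integrable_Z_exp[OF z, of 0] integrable_Z_exp[OF z, of 1]
    by (subst Bochner_Integration.integral_add) auto
  finally show "caputo_deriv \<beta> g t = c * (LINT p|(A \<Otimes>\<^sub>M B). exp (z * Z p)) +
      c * z * (LINT p|(A \<Otimes>\<^sub>M B). Z p * exp (z * Z p))" .
qed

end

section \<open>The Skellam field at independent random times\<close>

text \<open>
  Independence as a Fubini theorem: the diagonal map sends \<open>M\<close> to the product of its restrictions to the
  two generated sigma-algebras. In this form one can fix the random times and integrate over the field
  alone, with no regular conditional probabilities.
\<close>

lemma (in prob_space) nn_integral_indep_sets: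
  fixes E :: "'i \<Rightarrow> 'a set set"
  defines "F \<equiv> \<lambda>K. sigma (space M) (\<Union>i\<in>K. E i)"
  assumes E: "indep_sets E I" "\<And>i. i \<in> I \<Longrightarrow> Int_stable (E i)"
    and KL: "K \<inter> L = {}" "K \<subseteq> I" "L \<subseteq> I"
    and \<Phi>: "\<Phi> \<in> borel_measurable (F K \<Otimes>\<^sub>M F L)"
  shows "(\<integral>\<^sup>+\<omega>. \<Phi> (\<omega>, \<omega>) \<partial>M) = (\<integral>\<^sup>+\<omega>. \<integral>\<^sup>+\<omega>'. \<Phi> (\<omega>, \<omega>') \<partial>M \<partial>M)"
proof -
  have sub: "(\<Union>i\<in>J. E i) \<subseteq> events" if "J \<subseteq> I" for J
    using E(1) that unfolding indep_sets_def by blast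
  have Pow: "(\<Union>i\<in>J. E i) \<subseteq> Pow (space M)" if "J \<subseteq> I" for J
    using sub[OF that] sets.space_closed by blast
  have sets_F: "sets (F J) = sigma_sets (space M) (\<Union>i\<in>J. E i)" if "J \<subseteq> I" for J
    unfolding F_def using Pow[OF that] by (rule sets_measure_of)
  have space_F: "space (F J) = space M" if "J \<subseteq> I" for J
    unfolding F_def using Pow[OF that] by (rule space_measure_of)
  have id: "(\<lambda>\<omega>. \<omega>) \<in> measurable M (F J)" if "J \<subseteq> I" for J
    unfolding F_def using sub[OF that] Pow[OF that] by (intro measurable_measure_of) auto
  have "indep_sets (\<lambda>j. sigma_sets (space M) (\<Union>i\<in>case_bool K L j. E i)) UNIV"
    using KL E
    by (intro indep_sets_collect_sigma indep_sets_mono_index[OF _ E(1)])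
       (auto simp: disjoint_family_on_def split: bool.splits)
  moreover have "(\<lambda>j. sigma_sets (space M) (\<Union>i\<in>case_bool K L j. E i)) = case_bool (sets (F K)) (sets (F L))"
    using KL by (auto simp: fun_eq_iff sets_F split: bool.split)
  ultimately have "indep_set (sets (F K)) (sets (F L))"
    unfolding indep_set_def by simp
  moreover have "sigma_sets (space M) {(\<lambda>\<omega>. \<omega>) -` A \<inter> space M |A. A \<in> sets (F J)} = sets (F J)"
    if "J \<subseteq> I" for J
  proof -
    have "{(\<lambda>\<omega>. \<omega>) -` A \<inter> space M |A. A \<in> sets (F J)} = sets (F J)"
      using sets.sets_into_space[of _ "F J"] by (auto simp: space_F[OF that] Int_absorb2)
    thus ?thesis using sets.sigma_sets_eq[of "F J"] by (simp add: space_F[OF that])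
  qed
  ultimately have "indep_var (F K) (\<lambda>\<omega>. \<omega>) (F L) (\<lambda>\<omega>. \<omega>)"
    using id KL by (simp add: indep_var_eq)
  hence eq: "distr M (F K) (\<lambda>\<omega>. \<omega>) \<Otimes>\<^sub>M distr M (F L) (\<lambda>\<omega>. \<omega>) = distr M (F K \<Otimes>\<^sub>M F L) (\<lambda>\<omega>. (\<omega>, \<omega>))"
    by (simp add: indep_var_distribution_eq)
  interpret L: prob_space "distr M (F L) (\<lambda>\<omega>. \<omega>)" by (rule prob_space_distr[OF id[OF KL(3)]])
  note [measurable] = \<Phi> id[OF KL(2)] id[OF KL(3)]
  have "(\<integral>\<^sup>+\<omega>. \<Phi> (\<omega>, \<omega>) \<partial>M) = (\<integral>\<^sup>+p. \<Phi> p \<partial>distr M (F K \<Otimes>\<^sub>M F L) (\<lambda>\<omega>. (\<omega>, \<omega>)))"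
    by (rule nn_integral_distr[symmetric]) measurable
  also have "\<dots> = (\<integral>\<^sup>+\<omega>. \<integral>\<^sup>+\<omega>'. \<Phi> (\<omega>, \<omega>') \<partial>distr M (F L) (\<lambda>\<omega>. \<omega>) \<partial>distr M (F K) (\<lambda>\<omega>. \<omega>))"
    unfolding eq[symmetric] by (rule L.nn_integral_fst[symmetric]) measurable
  also have "\<dots> = (\<integral>\<^sup>+\<omega>. \<integral>\<^sup>+\<omega>'. \<Phi> (\<omega>, \<omega>') \<partial>distr M (F L) (\<lambda>\<omega>. \<omega>) \<partial>M)"
    by (rule nn_integral_distr) measurable
  also have "\<dots> = (\<integral>\<^sup>+\<omega>. \<integral>\<^sup>+\<omega>'. \<Phi> (\<omega>, \<omega>') \<partial>M \<partial>M)"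
  proof (rule nn_integral_cong)
    fix \<omega> assume "\<omega> \<in> space M"
    hence [measurable]: "\<omega> \<in> space (F K)" by (simp add: space_F[OF KL(2)])
    have "(\<lambda>\<omega>'. \<Phi> (\<omega>, \<omega>')) \<in> borel_measurable (F L)" by measurable
    thus "(\<integral>\<^sup>+\<omega>'. \<Phi> (\<omega>, \<omega>') \<partial>distr M (F L) (\<lambda>\<omega>. \<omega>)) = (\<integral>\<^sup>+\<omega>'. \<Phi> (\<omega>, \<omega>') \<partial>M)"
      by (intro nn_integral_distr id KL) simp
  qed
  finally show ?thesis .
qed

lemma rectangle_borel: "{0..a::real} \<times> {0..b::real} \<in> sets borel"
  by (intro borel_closed closed_Times) auto

lemma rectangle_quadrant: "{0..a} \<times> {0..b} \<subseteq> quadrant"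
  by (auto simp: quadrant_def)

lemma bounded_rectangle: "bounded ({0..a::real} \<times> {0..b::real})"
  by (intro bounded_Times bounded_closed_interval)

lemma measure_rectangle: "0 \<le> a \<Longrightarrow> 0 \<le> b \<Longrightarrow> emeasure lborel ({0..a::real} \<times> {0..b::real}) = ennreal (a * b)"
  by (simp add: lborel_prod[symmetric] lborel.emeasure_pair_measure_Times ennreal_mult')

text \<open>
  Continuity from above, written as a countable infimum over rational corners so that joint
  measurability in the corner and the outcome is immediate.
\<close>

lemma emeasure_rectangle_eq_INF:
  assumes sets: "sets \<mu> = sets (restrict_space borel quadrant)"
    and fin: "\<And>a b. emeasure \<mu> ({0..a} \<times> {0..b}) < \<infinity>"
  shows "emeasure \<mu> ({0..a} \<times> {0..b}) =
    (INF p::rat \<times> rat. if a < of_rat (fst p) \<and> b < of_rat (snd p)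
       then emeasure \<mu> ({0..of_rat (fst p)} \<times> {0..of_rat (snd p)}) else \<infinity>)"
    (is "_ = (INF p. ?f p)")
proof (rule antisym)
  have rect: "{0..a} \<times> {0..b} \<in> sets \<mu>" for a b :: real
    unfolding sets using rectangle_borel[of a b] rectangle_quadrant[of a b]
    by (subst sets_restrict_space_iff) (auto simp: quadrant_def intro!: borel_closed closed_Times)
  show "emeasure \<mu> ({0..a} \<times> {0..b}) \<le> (INF p. ?f p)"
    by (rule INF_greatest) (auto intro!: emeasure_mono rect)
  let ?R = "\<lambda>n::nat. {0..a + 1 / real (Suc n)} \<times> {0..b + 1 / real (Suc n)}"
  have lim: "(\<lambda>n. x + 1 / real (Suc n)) \<longlonglongrightarrow> x" for x :: real
    using tendsto_add[OF tendsto_const LIMSEQ_inverse_real_of_nat, of x] by (simp add: inverse_eq_divide)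
  have "(\<Inter>n. ?R n) = {0..a} \<times> {0..b}"
  proof (intro subset_antisym subsetI)
    fix p assume p: "p \<in> (\<Inter>n. ?R n)"
    hence "0 \<le> fst p" "0 \<le> snd p" by auto
    moreover have "fst p \<le> a" "snd p \<le> b"
      by (rule LIMSEQ_le_const[OF lim], use p in force)+
    ultimately show "p \<in> {0..a} \<times> {0..b}" by (cases p) auto
  qed (force intro: order_trans)
  moreover have "(\<lambda>n. emeasure \<mu> (?R n)) \<longlonglongrightarrow> emeasure \<mu> (\<Inter>n. ?R n)"
  proof (rule Lim_emeasure_decseq)
    show "range ?R \<subseteq> sets \<mu>" using rect by auto
    have "1 / real (Suc n) \<le> 1 / real (Suc m)" if "m \<le> n" for m n
      using that by (intro divide_left_mono) auto
    thus "decseq ?R" by (fastforce simp: decseq_def intro: order_trans)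
    show "emeasure \<mu> (?R n) \<noteq> \<infinity>" for n using fin[of "a + 1 / real (Suc n)"] by (simp add: less_top)
  qed
  ultimately have "(\<lambda>n. emeasure \<mu> (?R n)) \<longlonglongrightarrow> emeasure \<mu> ({0..a} \<times> {0..b})" by simp
  moreover have "(INF p. ?f p) \<le> emeasure \<mu> (?R n)" for n
  proof -
    have *: "\<exists>q::rat. x < of_rat q \<and> of_rat q < x + 1 / real (Suc n)" for x :: real
      by (rule of_rat_dense) simp
    obtain q r :: rat where qr: "a < of_rat q" "of_rat q < a + 1 / real (Suc n)"
        "b < of_rat r" "of_rat r < b + 1 / real (Suc n)"
      using *[of a] *[of b] by auto
    have "(INF p. ?f p) \<le> ?f (q, r)" by (rule INF_lower) simp
    also have "\<dots> \<le> emeasure \<mu> (?R n)"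
      using qr by (auto intro!: emeasure_mono rect)
    finally show ?thesis .
  qed
  ultimately show "(INF p. ?f p) \<le> emeasure \<mu> ({0..a} \<times> {0..b})"
    by (intro LIMSEQ_le_const) auto
qed

lemma integer_valued_random_measureD:
  assumes "integer_valued_random_measure M N"
  shows "B \<in> sets borel \<Longrightarrow> B \<subseteq> quadrant \<Longrightarrow> (\<lambda>\<omega>. emeasure (N \<omega>) B) \<in> borel_measurable M"
    and "B \<in> sets borel \<Longrightarrow> B \<subseteq> quadrant \<Longrightarrow> \<omega> \<in> space M \<Longrightarrow> emeasure (N \<omega>) B \<in> range ennreal_of_enat"
    and "B \<in> sets borel \<Longrightarrow> B \<subseteq> quadrant \<Longrightarrow> \<omega> \<in> space M \<Longrightarrow> bounded B \<Longrightarrow> emeasure (N \<omega>) B < \<infinity>"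
    and "\<omega> \<in> space M \<Longrightarrow> sets (N \<omega>) = sets (restrict_space borel quadrant)"
  using assms by (simp_all add: integer_valued_random_measure_def)

lemma poisson_random_fieldD:
  assumes "poisson_random_field M l N"
  shows "integer_valued_random_measure M N"
    and "B \<in> sets borel \<Longrightarrow> B \<subseteq> quadrant \<Longrightarrow> emeasure lborel B < \<infinity> \<Longrightarrow>
      measure M {\<omega> \<in> space M. emeasure (N \<omega>) B = of_nat k} =
        exp (- (l * measure lborel B)) * (l * measure lborel B) ^ k / fact k"
  using assms by (simp_all add: poisson_random_field_def)

lemma poisson_field_count:
  assumes N: "poisson_random_field M l N" and \<omega>: "\<omega> \<in> space M"
  obtains k :: nat where "emeasure (N \<omega>) ({0..a} \<times> {0..b}) = of_nat k" "field_at N a b \<omega> = real k"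
proof -
  note irm = poisson_random_fieldD(1)[OF N]
  have "emeasure (N \<omega>) ({0..a} \<times> {0..b}) \<in> range ennreal_of_enat" "emeasure (N \<omega>) ({0..a} \<times> {0..b}) < \<infinity>"
    by (rule integer_valued_random_measureD(2)[OF irm rectangle_borel rectangle_quadrant \<omega>],
        rule integer_valued_random_measureD(3)[OF irm rectangle_borel rectangle_quadrant \<omega> bounded_rectangle])
  then obtain e where e: "emeasure (N \<omega>) ({0..a} \<times> {0..b}) = ennreal_of_enat e" "ennreal_of_enat e < \<infinity>"
    by (metis imageE)
  then obtain k where "emeasure (N \<omega>) ({0..a} \<times> {0..b}) = of_nat k"
    by (cases e) auto
  thus thesis by (intro that[of k]) (auto simp: field_at_def measure_def ennreal_of_nat_eq_real_of_nat)
qed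

lemma measurable_random_field_at:
  assumes N: "integer_valued_random_measure M N" and F: "space F = space M"
    and meas: "\<And>B. B \<in> sets borel \<Longrightarrow> B \<subseteq> quadrant \<Longrightarrow> (\<lambda>\<omega>. emeasure (N \<omega>) B) \<in> borel_measurable F"
    and [measurable]: "A1 \<in> borel_measurable G" "A2 \<in> borel_measurable G"
  shows "(\<lambda>p. field_at N (A1 (fst p)) (A2 (fst p)) (snd p)) \<in> borel_measurable (G \<Otimes>\<^sub>M F)"
proof -
  let ?g = "\<lambda>p. INF q::rat \<times> rat. if A1 (fst p) < of_rat (fst q) \<and> A2 (fst p) < of_rat (snd q)
       then emeasure (N (snd p)) ({0..of_rat (fst q)} \<times> {0..of_rat (snd q)}) else \<infinity>"
  have [measurable]: "(\<lambda>\<omega>. emeasure (N \<omega>) ({0..a} \<times> {0..b})) \<in> borel_measurable F" for a b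
    by (intro meas rectangle_borel rectangle_quadrant)
  have g: "?g \<in> borel_measurable (G \<Otimes>\<^sub>M F)"
    by (intro borel_measurable_INF) measurable
  have eq: "emeasure (N (snd p)) ({0..A1 (fst p)} \<times> {0..A2 (fst p)}) = ?g p"
    if "p \<in> space (G \<Otimes>\<^sub>M F)" for p
  proof (rule emeasure_rectangle_eq_INF[of "N (snd p)" "A1 (fst p)" "A2 (fst p)"])
    have \<omega>: "snd p \<in> space M" using that unfolding space_pair_measure F by (cases p) simp
    show "sets (N (snd p)) = sets (restrict_space borel quadrant)"
      by (rule integer_valued_random_measureD(4)[OF N \<omega>])
    show "emeasure (N (snd p)) ({0..a} \<times> {0..b}) < \<infinity>" for a b
      by (rule integer_valued_random_measureD(3)[OF N rectangle_borel rectangle_quadrant \<omega> bounded_rectangle])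
  qed
  have [measurable]: "(\<lambda>p. emeasure (N (snd p)) ({0..A1 (fst p)} \<times> {0..A2 (fst p)})) \<in> borel_measurable (G \<Otimes>\<^sub>M F)"
    by (rule measurable_cong[THEN iffD2, OF eq g])
  show ?thesis unfolding field_at_def measure_def by measurable
qed

lemma nn_integral_poisson_field:
  assumes "prob_space M" and N: "poisson_random_field M l N" and l: "0 < l"
    and ab: "0 \<le> a" "0 \<le> b" and v: "0 < v"
  shows "(\<integral>\<^sup>+\<omega>. ennreal (v powr field_at N a b \<omega>) \<partial>M) = ennreal (exp (l * (v - 1) * (a * b)))"
proof -
  interpret prob_space M by fact
  let ?B = "{0..a} \<times> {0..b}"
  let ?m = "l * (a * b)"
  have m: "0 \<le> ?m" using ab l by simp
  have [measurable]: "(\<lambda>\<omega>. emeasure (N \<omega>) ?B) \<in> borel_measurable M"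
    by (rule integer_valued_random_measureD(1)[OF poisson_random_fieldD(1)[OF N] rectangle_borel rectangle_quadrant])
  have B: "measure lborel ?B = a * b" "emeasure lborel ?B < \<infinity>"
    using measure_rectangle[OF ab] ab by (auto simp: measure_def)
  have law: "emeasure M {\<omega> \<in> space M. emeasure (N \<omega>) ?B = of_nat k} = ennreal (exp (- ?m) * ?m ^ k / fact k)" for k :: nat
    using poisson_random_fieldD(2)[OF N rectangle_borel rectangle_quadrant B(2)]
    by (simp add: emeasure_eq_measure B(1))
  have "(\<integral>\<^sup>+\<omega>. ennreal (v powr field_at N a b \<omega>) \<partial>M) =
      (\<integral>\<^sup>+\<omega>. (\<Sum>k. ennreal (v ^ k) * indicator {\<omega> \<in> space M. emeasure (N \<omega>) ?B = of_nat k} \<omega>) \<partial>M)"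
  proof (rule nn_integral_cong)
    fix \<omega> assume \<omega>: "\<omega> \<in> space M"
    obtain k where k: "emeasure (N \<omega>) ?B = of_nat k" "field_at N a b \<omega> = real k"
      using poisson_field_count[OF N \<omega>] by blast
    have "(\<Sum>j. ennreal (v ^ j) * indicator {\<omega> \<in> space M. emeasure (N \<omega>) ?B = of_nat j} \<omega>) =
        (\<Sum>j\<in>{k}. ennreal (v ^ j) * indicator {\<omega> \<in> space M. emeasure (N \<omega>) ?B = of_nat j} \<omega>)"
      by (rule suminf_finite) (auto simp: k)
    thus "ennreal (v powr field_at N a b \<omega>) =
        (\<Sum>k. ennreal (v ^ k) * indicator {\<omega> \<in> space M. emeasure (N \<omega>) ?B = of_nat k} \<omega>)"
      using \<omega> v by (simp add: k powr_realpow)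
  qed
  also have "\<dots> = (\<Sum>k. \<integral>\<^sup>+\<omega>. ennreal (v ^ k) * indicator {\<omega> \<in> space M. emeasure (N \<omega>) ?B = of_nat k} \<omega> \<partial>M)"
    by (rule nn_integral_suminf) measurable
  also have "\<dots> = (\<Sum>k. ennreal (exp (- ?m) * ((v * ?m) ^ k / fact k)))"
    using v m by (intro suminf_cong) (simp add: nn_integral_cmult_indicator law power_mult_distrib mult_ac flip: ennreal_mult')
  also have "\<dots> = ennreal (exp (- ?m) * exp (v * ?m))"
  proof (rule suminf_ennreal_eq)
    show "(\<lambda>k. exp (- ?m) * ((v * ?m) ^ k / fact k)) sums (exp (- ?m) * exp (v * ?m))"
      using exp_converges[of "v * ?m"] by (intro sums_mult) (simp add: divide_inverse mult.commute)
  qed (use v m in simp)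
  also have "exp (- ?m) * exp (v * ?m) = exp (l * (v - 1) * (a * b))"
    by (simp add: algebra_simps flip: exp_add)
  finally show ?thesis .
qed

lemma Int_stable_process_sigma: "Int_stable (process_sigma M I K X)"
proof -
  have "sigma_algebra (space M) (process_sigma M I K X)"
    unfolding process_sigma_def by (rule sigma_algebra_sigma_sets) auto
  thus ?thesis
    by (simp add: sigma_algebra_def algebra_iff_Int Int_stable_def)
qed

lemma measurable_process_sigma:
  assumes "process_sigma M I K X \<subseteq> \<A>" "\<A> \<subseteq> Pow (space M)" "i \<in> I" "X i \<in> space M \<rightarrow> space K"
  shows "X i \<in> measurable (sigma (space M) \<A>) K"
proof (rule measurableI)
  fix A assume "A \<in> sets K"
  hence "X i -` A \<inter> space M \<in> process_sigma M I K X"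
    using assms(3) unfolding process_sigma_def by (intro sigma_sets.Basic) auto
  thus "X i -` A \<inter> space (sigma (space M) \<A>) \<in> sets (sigma (space M) \<A>)"
    using assms by (auto simp: space_measure_of sets_measure_of intro: sigma_sets.Basic)
qed (use assms in \<open>auto simp: space_measure_of\<close>)

text \<open>
  The time processes are arbitrary here: their measurability at nonnegative times is implicit in
  \<open>mutually_independent\<close>.
\<close>

locale independent_time_change = prob_space M
  for M :: "'w measure" +
  fixes N1 N2 :: "'w \<Rightarrow> (real \<times> real) measure" and E1 E2 :: "real \<Rightarrow> 'w \<Rightarrow> real" and l1 l2 :: real
  assumes rates: "0 < l1" "0 < l2"
    and poisson: "poisson_random_field M l1 N1" "poisson_random_field M l2 N2"
    and indep: "mutually_independent M N1 N2 E1 E2"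
begin

definition source :: "nat \<Rightarrow> 'w set set" where
  "source i = [random_measure_sigma M N1, random_measure_sigma M N2,
     process_sigma M {0..} borel E1, process_sigma M {0..} borel E2] ! i"

abbreviation info :: "nat set \<Rightarrow> 'w measure" where
  "info K \<equiv> sigma (space M) (\<Union>i\<in>K. source i)"

lemma indep_source: "indep_sets source {..<4}"
  using indep unfolding mutually_independent_def source_def .

lemma source_simps:
  "source 0 = random_measure_sigma M N1" "source 1 = random_measure_sigma M N2"
  "source (Suc 0) = random_measure_sigma M N2"
  "source 2 = process_sigma M {0..} borel E1" "source 3 = process_sigma M {0..} borel E2"
  by (simp_all add: source_def)

lemma less_4: "(i::nat) < 4 \<longleftrightarrow> i = 0 \<or> i = 1 \<or> i = 2 \<or> i = 3"
  by auto

lemma Int_stable_source: "i \<in> {..<4} \<Longrightarrow> Int_stable (source i)"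
  by (auto simp: less_4 source_simps random_measure_sigma_def Int_stable_process_sigma)

lemma source_events: "i < 4 \<Longrightarrow> source i \<subseteq> events"
  using indep_source by (auto simp: indep_sets_def)

lemma source_Pow: "K \<subseteq> {..<4} \<Longrightarrow> (\<Union>i\<in>K. source i) \<subseteq> Pow (space M)"
  using source_events sets.space_closed by blast

lemma space_info: "K \<subseteq> {..<4} \<Longrightarrow> space (info K) = space M"
  using source_Pow by (rule space_measure_of)

lemma measurable_info:
  assumes "K \<subseteq> {..<4}"
  shows "0 \<in> K \<Longrightarrow> B \<in> sets borel \<Longrightarrow> B \<subseteq> quadrant \<Longrightarrow> (\<lambda>\<omega>. emeasure (N1 \<omega>) B) \<in> borel_measurable (info K)"
    and "1 \<in> K \<Longrightarrow> B \<in> sets borel \<Longrightarrow> B \<subseteq> quadrant \<Longrightarrow> (\<lambda>\<omega>. emeasure (N2 \<omega>) B) \<in> borel_measurable (info K)"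
    and "2 \<in> K \<Longrightarrow> 0 \<le> s \<Longrightarrow> E1 s \<in> borel_measurable (info K)"
    and "3 \<in> K \<Longrightarrow> 0 \<le> s \<Longrightarrow> E2 s \<in> borel_measurable (info K)"
proof -
  note sub = UN_upper[of _ K source]
  show "(\<lambda>\<omega>. emeasure (N1 \<omega>) B) \<in> borel_measurable (info K)" if "0 \<in> K" "B \<in> sets borel" "B \<subseteq> quadrant"
    by (rule measurable_process_sigma[where X="\<lambda>B \<omega>. emeasure (N1 \<omega>) B" and i=B,
          OF sub[OF that(1), unfolded source_simps random_measure_sigma_def] source_Pow[OF assms]])
       (use that in auto)
  show "(\<lambda>\<omega>. emeasure (N2 \<omega>) B) \<in> borel_measurable (info K)" if "1 \<in> K" "B \<in> sets borel" "B \<subseteq> quadrant"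
    by (rule measurable_process_sigma[where X="\<lambda>B \<omega>. emeasure (N2 \<omega>) B" and i=B,
          OF sub[OF that(1), unfolded source_simps random_measure_sigma_def] source_Pow[OF assms]])
       (use that in auto)
  show "E1 s \<in> borel_measurable (info K)" if "2 \<in> K" "0 \<le> s"
    by (rule measurable_process_sigma[OF sub[OF that(1), unfolded source_simps] source_Pow[OF assms]])
       (use that in auto)
  show "E2 s \<in> borel_measurable (info K)" if "3 \<in> K" "0 \<le> s"
    by (rule measurable_process_sigma[OF sub[OF that(1), unfolded source_simps] source_Pow[OF assms]])
       (use that in auto)
qed

lemma measurable_info_events: "K \<subseteq> {..<4} \<Longrightarrow> f \<in> measurable (info K) L \<Longrightarrow> f \<in> measurable M L"
proof (erule measurable_mono[THEN subsetD, rotated -1])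
  assume K: "K \<subseteq> {..<4}"
  show "sets (info K) \<subseteq> sets M"
    using source_Pow[OF K] source_events K
    by (subst sets_measure_of) (auto intro!: sets.sigma_sets_subset)
qed (auto simp: space_info)

lemma nn_integral_info:
  assumes "K \<inter> L = {}" "K \<subseteq> {..<4}" "L \<subseteq> {..<4}" "\<Phi> \<in> borel_measurable (info K \<Otimes>\<^sub>M info L)"
  shows "(\<integral>\<^sup>+\<omega>. \<Phi> (\<omega>, \<omega>) \<partial>M) = (\<integral>\<^sup>+\<omega>. \<integral>\<^sup>+\<omega>'. \<Phi> (\<omega>, \<omega>') \<partial>M \<partial>M)"
  by (rule nn_integral_indep_sets[OF indep_source Int_stable_source assms])

definition rate :: "real \<Rightarrow> real" where
  "rate u = l1 * (u - 1) + l2 * (1 / u - 1)"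

lemma measurable_field_at:
  assumes "K \<subseteq> {..<4}"
  shows "0 \<in> K \<Longrightarrow> field_at N1 a b \<in> borel_measurable (info K)"
    and "1 \<in> K \<Longrightarrow> field_at N2 a b \<in> borel_measurable (info K)"
  unfolding field_at_def[abs_def] measure_def
  by (intro borel_measurable_enn2real measurable_info assms rectangle_borel rectangle_quadrant, assumption)+

lemma nn_integral_skellam:
  assumes u: "0 < u" and ab: "0 \<le> a" "0 \<le> b"
  shows "(\<integral>\<^sup>+\<omega>. ennreal (u powr skellam N1 N2 a b \<omega>) \<partial>M) = ennreal (exp (rate u * (a * b)))"
proof -
  let ?\<Phi> = "\<lambda>p. ennreal (u powr field_at N1 a b (fst p)) * ennreal ((1 / u) powr field_at N2 a b (snd p))"
  have [measurable]: "field_at N1 a b \<in> borel_measurable (info {0})" "field_at N2 a b \<in> borel_measurable (info {1})"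
    by (rule measurable_field_at; simp)+
  have [measurable]: "field_at N1 a b \<in> borel_measurable M" "field_at N2 a b \<in> borel_measurable M"
    by (rule measurable_info_events[of "{0}"], simp, measurable)
       (rule measurable_info_events[of "{1}"], simp, measurable)
  have "u powr (x - y) = u powr x * (1 / u) powr y" for x y
    using u by (simp add: powr_def ln_div right_diff_distrib algebra_simps flip: exp_add)
  hence "(\<integral>\<^sup>+\<omega>. ennreal (u powr skellam N1 N2 a b \<omega>) \<partial>M) = (\<integral>\<^sup>+\<omega>. ?\<Phi> (\<omega>, \<omega>) \<partial>M)"
    by (simp add: skellam_def ennreal_mult')
  also have "\<dots> = (\<integral>\<^sup>+\<omega>. \<integral>\<^sup>+\<omega>'. ?\<Phi> (\<omega>, \<omega>') \<partial>M \<partial>M)"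
    by (rule nn_integral_info[of "{0}" "{1}"], simp, simp, simp) measurable
  also have "\<dots> = (\<integral>\<^sup>+\<omega>. ennreal (u powr field_at N1 a b \<omega>) \<partial>M) * (\<integral>\<^sup>+\<omega>. ennreal ((1 / u) powr field_at N2 a b \<omega>) \<partial>M)"
    by (simp add: nn_integral_cmult nn_integral_multc)
  also have "\<dots> = ennreal (exp (l1 * (u - 1) * (a * b))) * ennreal (exp (l2 * (1 / u - 1) * (a * b)))"
    using u by (simp only: nn_integral_poisson_field[OF prob_space_axioms poisson(1) rates(1) ab u]
      nn_integral_poisson_field[OF prob_space_axioms poisson(2) rates(2) ab] zero_less_divide_iff zero_less_one simp_thms)
  also have "\<dots> = ennreal (exp (rate u * (a * b)))"
    by (simp add: rate_def algebra_simps flip: ennreal_mult' exp_add)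
  finally show ?thesis .
qed

lemma measurable_joint:
  assumes st: "0 \<le> s" "0 \<le> t"
  shows "(\<lambda>p. field_at N1 (E1 s (fst p)) (E2 t (fst p)) (snd p)) \<in> borel_measurable (info {2, 3} \<Otimes>\<^sub>M info {0, 1})"
    and "(\<lambda>p. field_at N2 (E1 s (fst p)) (E2 t (fst p)) (snd p)) \<in> borel_measurable (info {2, 3} \<Otimes>\<^sub>M info {0, 1})"
  by (rule measurable_random_field_at[where ?A1.0="E1 s" and ?A2.0="E2 t", OF poisson_random_fieldD(1)[OF poisson(1)]], rule space_info, simp,
        rule measurable_info(1), simp, simp, assumption, assumption,
        rule measurable_info(3), simp, simp, rule st, rule measurable_info(4), simp, simp, rule st)
     (rule measurable_random_field_at[where ?A1.0="E1 s" and ?A2.0="E2 t", OF poisson_random_fieldD(1)[OF poisson(2)]], rule space_info, simp,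
        rule measurable_info(2), simp, simp, assumption, assumption,
        rule measurable_info(3), simp, simp, rule st, rule measurable_info(4), simp, simp, rule st)

lemma measurable_fractional_skellam:
  assumes st: "0 \<le> s" "0 \<le> t"
  shows "fractional_skellam N1 N2 E1 E2 s t \<in> borel_measurable M"
proof -
  have id: "(\<lambda>\<omega>. \<omega>) \<in> measurable M (info K)" if "K \<subseteq> {..<4}" for K
    by (rule measurable_info_events[OF that]) simp
  have [measurable]: "(\<lambda>\<omega>. (\<omega>, \<omega>)) \<in> measurable M (info {2, 3} \<Otimes>\<^sub>M info {0, 1})"
    by (intro measurable_Pair id) auto
  show ?thesis
    using measurable_compose[OF \<open>(\<lambda>\<omega>. (\<omega>, \<omega>)) \<in> _\<close> measurable_joint(1)[OF st]]
      measurable_compose[OF \<open>(\<lambda>\<omega>. (\<omega>, \<omega>)) \<in> _\<close> measurable_joint(2)[OF st]]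
    unfolding fractional_skellam_def[abs_def] skellam_def by simp
qed

text \<open>
  First the field is separated from the times, then the two times from each other. Nonnegativity of
  the times holds only almost surely.
\<close>

lemma nn_integral_fractional_skellam:
  assumes u: "0 < u" and st: "0 \<le> s" "0 \<le> t"
    and nonneg: "AE \<omega> in M. 0 \<le> E1 s \<omega>" "AE \<omega> in M. 0 \<le> E2 t \<omega>"
  shows "(\<integral>\<^sup>+\<omega>. ennreal (u powr fractional_skellam N1 N2 E1 E2 s t \<omega>) \<partial>M) =
    (\<integral>\<^sup>+\<omega>. \<integral>\<^sup>+\<omega>'. ennreal (exp (rate u * (E1 s \<omega> * E2 t \<omega>'))) \<partial>M \<partial>M)"
proof -
  note [measurable] = measurable_joint[OF st]
  let ?\<Phi> = "\<lambda>p. ennreal (u powr (field_at N1 (E1 s (fst p)) (E2 t (fst p)) (snd p) -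
      field_at N2 (E1 s (fst p)) (E2 t (fst p)) (snd p)))"
  let ?\<Psi> = "\<lambda>p. ennreal (exp (rate u * (E1 s (fst p) * E2 t (snd p))))"
  have [measurable]: "E1 s \<in> borel_measurable (info {2})" "E2 t \<in> borel_measurable (info {3})"
    by (rule measurable_info; use st in simp)+
  have "(\<integral>\<^sup>+\<omega>. ennreal (u powr fractional_skellam N1 N2 E1 E2 s t \<omega>) \<partial>M) = (\<integral>\<^sup>+\<omega>. ?\<Phi> (\<omega>, \<omega>) \<partial>M)"
    by (simp add: fractional_skellam_def skellam_def)
  also have "\<dots> = (\<integral>\<^sup>+\<omega>. \<integral>\<^sup>+\<omega>'. ?\<Phi> (\<omega>, \<omega>') \<partial>M \<partial>M)"
    by (rule nn_integral_info[of "{2, 3}" "{0, 1}"], simp, simp, simp) measurable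
  also have "\<dots> = (\<integral>\<^sup>+\<omega>. ?\<Psi> (\<omega>, \<omega>) \<partial>M)"
  proof (rule nn_integral_cong_AE)
    show "AE \<omega> in M. (\<integral>\<^sup>+\<omega>'. ?\<Phi> (\<omega>, \<omega>') \<partial>M) = ?\<Psi> (\<omega>, \<omega>)"
      using nonneg by eventually_elim (use nn_integral_skellam[OF u] in \<open>simp add: skellam_def\<close>)
  qed
  also have "\<dots> = (\<integral>\<^sup>+\<omega>. \<integral>\<^sup>+\<omega>'. ?\<Psi> (\<omega>, \<omega>') \<partial>M \<partial>M)"
    by (rule nn_integral_info[of "{2}" "{3}"], simp, simp, simp) measurable
  finally show ?thesis by simp
qed

end

section \<open>The fractional differential equation\<close>

text \<open>
  The two Mittag-Leffler variables are placed on the product of \<open>M\<close> with itself, which makes them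
  independent by construction; only the joint law of the two times enters.
\<close>

locale fractional_skellam_field =
  independent_time_change M N1 N2 "inverse_process H1" "inverse_process H2" l1 l2 +
  H1: subordinator M \<alpha> H1 + H2: subordinator M \<beta> H2
  for M :: "'w measure" and N1 N2 H1 H2 l1 l2 \<alpha> \<beta>
begin

abbreviation S :: "real \<Rightarrow> real \<Rightarrow> 'w \<Rightarrow> real" where
  "S \<equiv> fractional_skellam N1 N2 (inverse_process H1) (inverse_process H2)"

sublocale law: stable_product M \<alpha> "\<lambda>\<omega>. H1 1 \<omega> powr (- \<alpha>)" M \<beta> "\<lambda>\<omega>. H2 1 \<omega> powr (- \<beta>)"
  by unfold_locales
     (use H1.index H2.index in \<open>auto simp: H1.moments_inverse H2.moments_inverse intro: H1.measurable_H1 H2.measurable_H1\<close>)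

lemma nn_integral_power_S:
  assumes u: "0 < u" and st: "0 \<le> s" "0 \<le> t"
  shows "(\<integral>\<^sup>+\<omega>. ennreal (u powr S s t \<omega>) \<partial>M) =
    (\<integral>\<^sup>+p. ennreal (exp (rate u * s powr \<alpha> * t powr \<beta> * law.Z p)) \<partial>(M \<Otimes>\<^sub>M M))"
proof -
  let ?E1 = "inverse_process H1 s" and ?E2 = "inverse_process H2 t"
  let ?X = "\<lambda>\<omega>. s powr \<alpha> * H1 1 \<omega> powr (- \<alpha>)" and ?Y = "\<lambda>\<omega>. t powr \<beta> * H2 1 \<omega> powr (- \<beta>)"
  have [measurable]: "?E1 \<in> borel_measurable M" "?E2 \<in> borel_measurable M"
    by (rule measurable_info_events[of "{2}"], simp, rule measurable_info(3), use st in simp_all)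
       (rule measurable_info_events[of "{3}"], simp, rule measurable_info(4), use st in simp_all)
  have nonneg: "AE \<omega> in M. 0 \<le> ?E1 \<omega>" "AE \<omega> in M. 0 \<le> ?E2 \<omega>"
    using H1.AE_inverse_process[OF st(1)] H2.AE_inverse_process[OF st(2)] by (auto elim!: eventually_mono)
  have subst_law: "(\<integral>\<^sup>+\<omega>. f (E \<omega>) \<partial>M) = (\<integral>\<^sup>+\<omega>. f (E' \<omega>) \<partial>M)"
    if "distr M borel E = distr M borel E'"
      and [measurable]: "E \<in> borel_measurable M" "E' \<in> borel_measurable M" "f \<in> borel_measurable borel"
    for f :: "real \<Rightarrow> ennreal" and E E'
  proof -
    have "(\<integral>\<^sup>+\<omega>. f (E \<omega>) \<partial>M) = (\<integral>\<^sup>+x. f x \<partial>distr M borel E)"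
      by (rule nn_integral_distr[symmetric]) measurable
    also have "\<dots> = (\<integral>\<^sup>+\<omega>. f (E' \<omega>) \<partial>M)"
      unfolding that(1) by (rule nn_integral_distr) measurable
    finally show ?thesis .
  qed
  have law2: "(\<integral>\<^sup>+\<omega>'. ennreal (exp (rate u * (x * ?E2 \<omega>'))) \<partial>M) = (\<integral>\<^sup>+\<omega>'. ennreal (exp (rate u * (x * ?Y \<omega>'))) \<partial>M)" for x
    by (rule subst_law[of ?E2 ?Y "\<lambda>y. ennreal (exp (rate u * (x * y)))"]) (use H2.distr_inverse_process st in auto)
  have "(\<integral>\<^sup>+\<omega>. ennreal (u powr S s t \<omega>) \<partial>M) =
      (\<integral>\<^sup>+\<omega>. \<integral>\<^sup>+\<omega>'. ennreal (exp (rate u * (?E1 \<omega> * ?E2 \<omega>'))) \<partial>M \<partial>M)"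
    by (rule nn_integral_fractional_skellam[OF u st nonneg])
  also have "\<dots> = (\<integral>\<^sup>+\<omega>. \<integral>\<^sup>+\<omega>'. ennreal (exp (rate u * (?E1 \<omega> * ?Y \<omega>'))) \<partial>M \<partial>M)"
    by (simp only: law2)
  also have "\<dots> = (\<integral>\<^sup>+\<omega>. \<integral>\<^sup>+\<omega>'. ennreal (exp (rate u * (?X \<omega> * ?Y \<omega>'))) \<partial>M \<partial>M)"
    by (rule subst_law[of ?E1 ?X "\<lambda>x. \<integral>\<^sup>+\<omega>'. ennreal (exp (rate u * (x * ?Y \<omega>'))) \<partial>M"])
       (use H1.distr_inverse_process st in auto)
  also have "\<dots> = (\<integral>\<^sup>+\<omega>. \<integral>\<^sup>+\<omega>'. ennreal (exp (rate u * s powr \<alpha> * t powr \<beta> * law.Z (\<omega>, \<omega>'))) \<partial>M \<partial>M)"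
    by (simp add: law.Z_def mult_ac)
  also have "\<dots> = (\<integral>\<^sup>+p. ennreal (exp (rate u * s powr \<alpha> * t powr \<beta> * law.Z p)) \<partial>(M \<Otimes>\<^sub>M M))"
    by (rule nn_integral_fst) measurable
  finally show ?thesis .
qed

text \<open>
  Identifies the condition in \<open>pgf_domain\<close> with finiteness of an exponential moment of \<open>Z\<close>.
\<close>

lemma integrable_power_S_iff:
  assumes "0 < u" "0 \<le> s" "0 \<le> t"
  shows "integrable M (\<lambda>\<omega>. u powr S s t \<omega>) \<longleftrightarrow> rate u * s powr \<alpha> * t powr \<beta> \<in> law.exp_domain"
proof -
  note [measurable] = measurable_fractional_skellam[OF assms(2,3)]
  show ?thesis
    unfolding law.exp_domain_def by (simp add: integrable_iff_bounded nn_integral_power_S[OF assms])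
qed

lemma pgf_S:
  assumes "0 < u" "0 \<le> s" "0 \<le> t"
  shows "pgf M (S s t) u = (LINT p|(M \<Otimes>\<^sub>M M). exp (rate u * s powr \<alpha> * t powr \<beta> * law.Z p))"
proof -
  note [measurable] = measurable_fractional_skellam[OF assms(2,3)]
  show ?thesis
    unfolding pgf_def by (simp add: integral_eq_nn_integral nn_integral_power_S[OF assms])
qed

lemma pgf_S_boundary:
  assumes "0 < u" "0 \<le> s" "0 \<le> t" "s = 0 \<or> t = 0"
  shows "pgf M (S s t) u = 1"
  using assms(4) by (auto simp: pgf_S[OF assms(1-3)] law.AB.P.prob_space)

lemma rate_has_derivative:
  assumes "u \<noteq> 0" shows "(rate has_real_derivative (l1 * u\<^sup>2 - l2) / u\<^sup>2) (at u within A)"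
  unfolding rate_def[abs_def] using assms
  by (auto intro!: derivative_eq_intros simp: field_simps power2_eq_square)

text \<open>
  Chain rule along \<open>v \<mapsto> rate v * p\<close>, which maps \<open>pgf_domain\<close> into \<open>exp_domain\<close>.
\<close>

lemma pgf_S_has_derivative:
  assumes u: "u \<in> pgf_domain M (S s t)" and st: "0 \<le> s" "0 \<le> t"
  defines "p \<equiv> s powr \<alpha> * t powr \<beta>"
  shows "((\<lambda>v. pgf M (S s t) v) has_real_derivative
      (LINT q|(M \<Otimes>\<^sub>M M). law.Z q * exp (rate u * p * law.Z q)) * ((l1 * u\<^sup>2 - l2) / u\<^sup>2 * p))
    (at u within pgf_domain M (S s t))"
proof -
  let ?D = "pgf_domain M (S s t)"
  let ?\<phi> = "\<lambda>z. LINT q|(M \<Otimes>\<^sub>M M). exp (z * law.Z q)"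
  have pos: "0 < v" if "v \<in> ?D" for v using that by (simp add: pgf_domain_def)
  have dom: "rate v * p \<in> law.exp_domain" if "v \<in> ?D" for v
    using integrable_power_S_iff[OF pos[OF that] st] that by (simp add: pgf_domain_def p_def mult.assoc)
  have "(?\<phi> has_real_derivative (LINT q|(M \<Otimes>\<^sub>M M). law.Z q * exp (rate u * p * law.Z q)))
      (at (rate u * p) within (\<lambda>v. rate v * p) ` ?D)"
    using law.has_derivative_on_exp_domain[OF dom[OF u]] by (rule DERIV_subset) (use dom in auto)
  moreover have "((\<lambda>v. rate v * p) has_real_derivative (l1 * u\<^sup>2 - l2) / u\<^sup>2 * p) (at u within ?D)"
    by (rule DERIV_cmult_right) (rule rate_has_derivative, use pos[OF u] in simp)
  ultimately have "(?\<phi> \<circ> (\<lambda>v. rate v * p) has_real_derivative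
      (LINT q|(M \<Otimes>\<^sub>M M). law.Z q * exp (rate u * p * law.Z q)) * ((l1 * u\<^sup>2 - l2) / u\<^sup>2 * p)) (at u within ?D)"
    by (rule DERIV_image_chain)
  thus ?thesis
    by (rule has_field_derivative_transform_within[OF _ zero_less_one u])
       (use pos st in \<open>simp add: pgf_S p_def mult.assoc\<close>)
qed

lemma fractional_equation:
  assumes s: "0 < s" and t: "0 < t" and u: "u \<in> pgf_domain M (S s t)" and nz: "l1 * u\<^sup>2 - l2 \<noteq> 0"
  defines "G \<equiv> \<lambda>u s t. pgf M (S s t) u"
  shows "\<forall>\<tau>\<in>{0<..t}. caputo_differentiable \<alpha> (\<lambda>\<sigma>. G u \<sigma> \<tau>) s"
    and "caputo_differentiable \<beta> (\<lambda>\<tau>. caputo_deriv \<alpha> (\<lambda>\<sigma>. G u \<sigma> \<tau>) s) t"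
    and "\<exists>D. ((\<lambda>v. G v s t) has_real_derivative D) (at u within pgf_domain M (S s t)) \<and>
           caputo_deriv \<beta> (\<lambda>\<tau>. caputo_deriv \<alpha> (\<lambda>\<sigma>. G u \<sigma> \<tau>) s) t =
             (l1 * (u - 1) + l2 * (1 / u - 1)) * G u s t +
             (l1 * (u - 1) * u + l2 * (1 - u))\<^sup>2 / (l1 * u\<^sup>2 - l2) * D"
proof -
  have u0: "0 < u" using u by (simp add: pgf_domain_def)
  let ?c = "rate u" and ?p = "s powr \<alpha> * t powr \<beta>"
  let ?z = "?c * s powr \<alpha> * t powr \<beta>"
  let ?\<phi> = "LINT q|(M \<Otimes>\<^sub>M M). exp (?z * law.Z q)" and ?\<phi>' = "LINT q|(M \<Otimes>\<^sub>M M). law.Z q * exp (?z * law.Z q)"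
  have z: "?z \<in> law.exp_domain"
    using integrable_power_S_iff[OF u0] s t u by (simp add: pgf_domain_def)
  have dom: "?c * s powr \<alpha> * \<tau> powr \<beta> \<in> law.exp_domain" if "0 < \<tau>" "\<tau> \<le> t" for \<tau>
    using law.max_0_in_exp_domain[OF z] power_time_le[of \<tau> t \<beta> "?c * s powr \<alpha>"] that H2.index
    by (auto intro: law.exp_domain_down)
  have G: "G u \<sigma> \<tau> = (LINT q|(M \<Otimes>\<^sub>M M). exp (?c * \<sigma> powr \<alpha> * \<tau> powr \<beta> * law.Z q))" if "0 < \<sigma>" "0 < \<tau>" for \<sigma> \<tau>
    using that u0 by (simp add: G_def pgf_S)
  have first: "caputo_differentiable \<alpha> (\<lambda>\<sigma>. G u \<sigma> \<tau>) s"
      "caputo_deriv \<alpha> (\<lambda>\<sigma>. G u \<sigma> \<tau>) s = ?c * \<tau> powr \<beta> *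
        (LINT q|(M \<Otimes>\<^sub>M M). H2 1 (snd q) powr (- \<beta>) * exp (?c * s powr \<alpha> * \<tau> powr \<beta> * law.Z q))"
    if "0 < \<tau>" "\<tau> \<le> t" for \<tau>
    by (rule law.caputo_first[OF s dom[OF that]], rule G, assumption, rule that(1))+
  show "\<forall>\<tau>\<in>{0<..t}. caputo_differentiable \<alpha> (\<lambda>\<sigma>. G u \<sigma> \<tau>) s"
    using first(1) by simp
  note second = law.caputo_second[where g="\<lambda>\<tau>. caputo_deriv \<alpha> (\<lambda>\<sigma>. G u \<sigma> \<tau>) s",
    OF t z first(2)[OF _ less_imp_le]]
  show "caputo_differentiable \<beta> (\<lambda>\<tau>. caputo_deriv \<alpha> (\<lambda>\<sigma>. G u \<sigma> \<tau>) s) t"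
    by (rule second(1))
  let ?D = "?\<phi>' * ((l1 * u\<^sup>2 - l2) / u\<^sup>2 * ?p)"
  have "((\<lambda>v. G v s t) has_real_derivative ?D) (at u within pgf_domain M (S s t))"
    unfolding G_def using pgf_S_has_derivative[OF u] s t by (simp add: mult.assoc)
  moreover have "caputo_deriv \<beta> (\<lambda>\<tau>. caputo_deriv \<alpha> (\<lambda>\<sigma>. G u \<sigma> \<tau>) s) t = ?c * ?\<phi> + ?c * ?z * ?\<phi>'"
    by (rule second(2))
  moreover have "?c * ?z * ?\<phi>' = (l1 * (u - 1) * u + l2 * (1 - u))\<^sup>2 / (l1 * u\<^sup>2 - l2) * ?D"
  proof -
    have "l1 * (u - 1) * u + l2 * (1 - u) = ?c * u"
      using u0 by (simp add: rate_def field_simps)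
    thus ?thesis using nz u0 by (simp add: power_mult_distrib power2_eq_square[of ?c] mult_ac)
  qed
  ultimately show "\<exists>D. ((\<lambda>v. G v s t) has_real_derivative D) (at u within pgf_domain M (S s t)) \<and>
      caputo_deriv \<beta> (\<lambda>\<tau>. caputo_deriv \<alpha> (\<lambda>\<sigma>. G u \<sigma> \<tau>) s) t =
        (l1 * (u - 1) + l2 * (1 / u - 1)) * G u s t +
        (l1 * (u - 1) * u + l2 * (1 - u))\<^sup>2 / (l1 * u\<^sup>2 - l2) * D"
    unfolding G[OF s t] by (intro exI[of _ ?D]) (simp add: rate_def)
qed

end

theorem proposition5p2:
  fixes M :: "'w measure"
    and N1 N2 :: "'w \<Rightarrow> (real \<times> real) measure"
    and H1 H2 :: "real \<Rightarrow> 'w \<Rightarrow> real"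
    and S :: "real \<Rightarrow> real \<Rightarrow> 'w \<Rightarrow> real"
    and G :: "real \<Rightarrow> real \<Rightarrow> real \<Rightarrow> real"
    and \<alpha> \<beta> l1 l2 :: real
  defines "S \<equiv> fractional_skellam N1 N2 (inverse_process H1) (inverse_process H2)"
    and "G \<equiv> (\<lambda>u s t. pgf M (S s t) u)"
  assumes "prob_space M"
    and "0 < \<alpha>" "\<alpha> < 1" "0 < \<beta>" "\<beta> < 1" "0 < l1" "0 < l2"
    and "poisson_random_field M l1 N1" "poisson_random_field M l2 N2"
    and "stable_subordinator M \<alpha> H1" "stable_subordinator M \<beta> H2"
    and "mutually_independent M N1 N2 (inverse_process H1) (inverse_process H2)"
  shows "(\<forall>s>0. \<forall>t>0. \<forall>u\<in>pgf_domain M (S s t). l1 * u\<^sup>2 - l2 \<noteq> 0 \<longrightarrow>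
            (\<forall>\<tau>\<in>{0<..t}. caputo_differentiable \<alpha> (\<lambda>\<sigma>. G u \<sigma> \<tau>) s) \<and>
            caputo_differentiable \<beta> (\<lambda>\<tau>. caputo_deriv \<alpha> (\<lambda>\<sigma>. G u \<sigma> \<tau>) s) t \<and>
            (\<exists>D. ((\<lambda>v. G v s t) has_real_derivative D) (at u within pgf_domain M (S s t)) \<and>
               caputo_deriv \<beta> (\<lambda>\<tau>. caputo_deriv \<alpha> (\<lambda>\<sigma>. G u \<sigma> \<tau>) s) t =
                 (l1 * (u - 1) + l2 * (1 / u - 1)) * G u s t +
                 (l1 * (u - 1) * u + l2 * (1 - u))\<^sup>2 / (l1 * u\<^sup>2 - l2) * D)) \<and>
         (\<forall>u\<in>{0<..1}. (\<forall>t\<ge>0. G u 0 t = 1) \<and> (\<forall>s\<ge>0. G u s 0 = 1))"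
proof -
  interpret field: fractional_skellam_field M N1 N2 H1 H2 l1 l2 \<alpha> \<beta>
    using assms by (intro fractional_skellam_field.intro independent_time_change.intro subordinator.intro
      independent_time_change_axioms.intro subordinator_axioms.intro)
  show ?thesis
    unfolding S_def G_def
    using field.fractional_equation field.pgf_S_boundary by (auto simp del: power2_eq_square)
qed

end
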